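(* Let $f$ be a complex-valued function on $\mathbb{R}_+=(0,\infty)$ which is represented by the integral $$f(x)=\int_{-\pi}^{\pi}e^{-x\cosh(u)}\varphi(u)\,du,\qquad x>0,$$ where $\varphi(u)=\psi(u)\sinh(u)$ and $\psi$ is a $2\pi$-periodic function satisfying the Lipschitz condition on $[-\pi,\pi]$, i.e. there is an absolute constant $C>0$ with $$|\psi(u)-\psi(v)|\le C|u-v|\qquad\text{for all }u,v\in[-\pi,\pi].$$ Then for all $x>0$ $$f(x)=\frac{2}{x\pi^2}\sum_{n=1}^\infty n\sinh(\pi n)\,J(x,in,\pi)\int_0^\infty K_{in}(y)f(y)\,dy .$$ Further, if $f$ can be expanded in terms of the series $$f(x)=\sum_{m=1}^\infty a_m K_{im}(x),\qquad x>0,$$ for a suitable sequence $\{a_m\}_{m\in\mathbb{N}}$ satisfying $\sum_{m=1}^\infty|a_m|e^{-\pi m/2}<\infty$, then for all $x>0$ $$f(x)=\frac{2}{\pi^2}\sum_{n=1}^\infty n\sinh(\pi n)\,K_{in}(x)\int_0^\infty J(y,in,\pi)f(y)\,\frac{dy}{y}.$$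
   Context: $\mathbb{N}=\{1,2,\dots\}$ and $i$ is the imaginary unit. $K_\nu$ is the modified Bessel (Macdonald) function, $K_\nu(x)=\int_0^\infty e^{-x\cosh u}\cosh(\nu u)\,du$ for $x>0$, $\nu\in\mathbb{C}$; thus $K_{in}(x)=\int_0^\infty e^{-x\cosh u}\cos(nu)\,du$. The incomplete modified Bessel function is $J(z,\nu,w)=\int_0^w e^{-z\cosh u}\cosh(\nu u)\,du$; thus $J(x,in,\pi)=\int_0^\pi e^{-x\cosh u}\cos(nu)\,du$. *)

theory Defs
  imports "HOL-Analysis.Analysis"
begin

text \<open>
  The order \<open>\<nu>\<close> comes first in \<open>bessel_K\<close>; the argument order of \<open>bessel_J_inc\<close>
  is \<open>J(z, \<nu>, w)\<close>. The integral in \<open>bessel_K\<close> converges (absolutely) only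
  for \<open>x > 0\<close>.
\<close>

definition bessel_K :: "complex \<Rightarrow> real \<Rightarrow> complex" where
  "bessel_K \<nu> x =
     (LBINT u=0..\<infinity>. complex_of_real (exp (- x * cosh u)) * cosh (\<nu> * complex_of_real u))"

definition bessel_J_inc :: "complex \<Rightarrow> complex \<Rightarrow> real \<Rightarrow> complex" where
  "bessel_J_inc z \<nu> w =
     (LBINT u=0..w. exp (- z * cosh (complex_of_real u)) * cosh (\<nu> * complex_of_real u))"

end

theory Submission
  imports Defs
begin

text \<open>
  Both expansions rest on the Laplace integral
  \<open>\<integral> exp (- y cosh u) K\<^bsub>in\<^esub>(y) dy = \<pi> sin (n u) / (sinh (\<pi> n) sinh u)\<close> over \<open>y > 0\<close>
  (\<open>laplace_macdonald\<close>) and on the identity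
  \<open>J(x, in, \<pi>) = (x / n) \<integral> exp (- x cosh u) sinh u sin (n u) du\<close> over \<open>[0, \<pi>]\<close>, which is integration
  by parts (\<open>bessel_J_inc_eq\<close>). They turn the integrals against \<open>K\<^bsub>in\<^esub>\<close> and the functions
  \<open>J(x, in, \<pi>)\<close> into sine coefficients on \<open>[0, \<pi>]\<close>.

  For the first expansion, put \<open>h(u) = \<psi>(u) - \<psi>(-u)\<close>, so that \<open>f(x)\<close> is the integral of
  \<open>exp (- x cosh u) sinh u h(u)\<close> over \<open>[0, \<pi>]\<close>. The integral of \<open>K\<^bsub>in\<^esub> f\<close> is \<open>\<pi> / sinh (\<pi> n)\<close> times the
  \<open>n\<close>-th sine coefficient of \<open>h\<close>, and the series becomes Parseval's identity for \<open>h\<close> and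
  \<open>exp (- x cosh u) sinh u\<close> (\<open>parseval_sine\<close>).

  For the second expansion, the same two facts show that \<open>J(y, in, \<pi>) / y\<close> and \<open>K\<^bsub>im\<^esub>(y)\<close> are
  biorthogonal on the half line, with constant \<open>\<pi>\<^sup>2 / (2 n sinh (\<pi> n))\<close> for \<open>m = n\<close>. It remains to integrate
  the series of \<open>f\<close> term by term. Since \<open>J(y, in, \<pi>) / y\<close> is at most a constant times \<open>exp (- y)\<close>,
  this needs the integral of \<open>exp (- y) \<bar>K\<^bsub>im\<^esub>(y)\<bar>\<close> to be \<open>O(exp (- \<pi> m / 2))\<close>, which follows from
  the bound \<open>\<pi> / sinh (\<pi> m)\<close> on the integral of \<open>K\<^bsub>im\<^esub>\<^sup>2\<close> (\<open>integral_macdonald_square\<close>).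

  By Fubini's theorem the Laplace integral is the integral of \<open>cos (n v) / (cosh u + cosh v)\<close>. Since
  \<open>2 sinh u / (cosh u + cosh v)\<close> is the difference of two translates of \<open>tanh (v / 2)\<close>, this reduces to
  the sine transform of \<open>1 - tanh (w / 2)\<close>, which a geometric series expresses by the partial fractions
  of \<open>1 / sinh (\<pi> n)\<close>. These are again an instance of Parseval's identity.
\<close>

section \<open>Completeness of the sine system on the interval from 0 to \<pi>\<close>

text \<open>
  The \<open>n\<close>-th sine coefficient of \<open>h\<close> on \<open>[0, \<pi>]\<close>, without normalising factor.
\<close>

definition sine_coeff :: "(real \<Rightarrow> real) \<Rightarrow> nat \<Rightarrow> real" where
  "sine_coeff h n = integral {0..pi} (\<lambda>u. h u * sin (real n * u))"

lemma has_integral_cos_int: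
  "((\<lambda>u. cos (real_of_int c * u)) has_integral (if c = 0 then pi else 0)) {0..pi}"
proof (cases "c = 0")
  case True
  then show ?thesis using has_integral_const_real[of "1::real" 0 pi] by simp
next
  case False
  have "((\<lambda>u. cos (of_int c * u)) has_integral (sin (of_int c * pi) / of_int c - sin (of_int c * 0) / of_int c)) {0..pi}"
    by (rule fundamental_theorem_of_calculus)
       (use False in \<open>auto intro!: derivative_eq_intros simp flip: has_real_derivative_iff_has_vector_derivative\<close>)
  moreover have "sin (of_int c * pi) = 0" 
    using sin_zero_iff_int2 by blast
  ultimately show ?thesis using False by simp
qed

lemma sine_coeff_sin:
  assumes "m \<ge> 1"
  shows "sine_coeff (\<lambda>u. sin (real m * u)) n = (if m = n then pi / 2 else 0)"
proof -
  have "((\<lambda>u. (cos (of_int (int m - int n) * u) - cos (of_int (int m + int n) * u)) / 2) has_integral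
      ((if int m - int n = 0 then pi else 0) - (if int m + int n = 0 then pi else 0)) / 2) {0..pi}"
    by (intro has_integral_divide has_integral_diff has_integral_cos_int)
  moreover have "(\<lambda>u. (cos (of_int (int m - int n) * u) - cos (of_int (int m + int n) * u)) / 2)
     = (\<lambda>u. sin (real m * u) * sin (real n * u))"
    by (auto simp: fun_eq_iff sin_times_sin left_diff_distrib distrib_right)
  ultimately have "((\<lambda>u. sin (real m * u) * sin (real n * u)) has_integral (if m = n then pi / 2 else 0)) {0..pi}"
    using assms by (simp split: if_splits)
  then show ?thesis unfolding sine_coeff_def by (rule integral_unique)
qed

text \<open>
  The inner product of real functions on \<open>[0, \<pi>]\<close>.
\<close>

definition ip :: "(real \<Rightarrow> real) \<Rightarrow> (real \<Rightarrow> real) \<Rightarrow> real" where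
  "ip h g = integral {0..pi} (\<lambda>u. h u * g u)"

lemma ip_commute: "ip h g = ip g h"
  by (simp add: ip_def mult.commute)

lemma ip_add: 
  assumes "continuous_on {0..pi} h" "continuous_on {0..pi} k" "continuous_on {0..pi} g"
  shows "ip (\<lambda>u. h u + k u) g = ip h g + ip k g"
  unfolding ip_def distrib_right
  by (intro integral_add integrable_continuous_interval continuous_intros assms)

lemma ip_scale: "ip (\<lambda>u. c * h u) g = c * ip h g"
  unfolding ip_def by (simp add: mult.assoc)

lemma ip_self_nonneg: "ip h h \<ge> 0"
  unfolding ip_def by (cases "(\<lambda>u. h u * h u) integrable_on {0..pi}") 
   (auto intro!: integral_nonneg simp: not_integrable_integral)

lemma sine_coeff_ip: "sine_coeff h n = ip h (\<lambda>u. sin (real n * u))"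
  by (simp add: ip_def sine_coeff_def)

lemma ip_sum: 
  assumes "\<And>k. k \<in> A \<Longrightarrow> continuous_on {0..pi} (h k)" "continuous_on {0..pi} g" "finite A"
  shows "ip (\<lambda>u. \<Sum>k\<in>A. c k * h k u) g = (\<Sum>k\<in>A. c k * ip (h k) g)"
  using assms(3,1)
proof (induction A rule: finite_induct)
  case empty then show ?case by (simp add: ip_def)
next
  case (insert x A)
  have "ip (\<lambda>u. c x * h x u + (\<Sum>k\<in>A. c k * h k u)) g = ip (\<lambda>u. c x * h x u) g + ip (\<lambda>u. \<Sum>k\<in>A. c k * h k u) g"
    by (intro ip_add assms(2) continuous_intros insert) (use insert in auto)
  then show ?case using insert by (simp add: ip_scale)
qed

text \<open>
  The error after \<open>N\<close> terms in the Parseval identity. For continuous functions it is a symmetric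
  bilinear form, and it equals the inner product of \<open>h - P h\<close> and \<open>g - P g\<close>, where \<open>P\<close> is the
  orthogonal projection onto the span of \<open>sin u, \<dots>, sin (N u)\<close>. Hence it is positive semidefinite,
  it is dominated by \<open>ip\<close>, and it vanishes on that span; these three properties
  are all that the proof of Parseval's identity needs.
\<close>

definition parseval_defect :: "nat \<Rightarrow> (real \<Rightarrow> real) \<Rightarrow> (real \<Rightarrow> real) \<Rightarrow> real" where
  "parseval_defect N h g = ip h g - 2 / pi * (\<Sum>k<N. sine_coeff h (Suc k) * sine_coeff g (Suc k))"

lemma parseval_defect_commute: "parseval_defect N h g = parseval_defect N g h"
  by (simp add: parseval_defect_def ip_commute mult.commute)

lemma parseval_defect_add:
  assumes "continuous_on {0..pi} h" "continuous_on {0..pi} k" "continuous_on {0..pi} g"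
  shows "parseval_defect N (\<lambda>u. h u + k u) g = parseval_defect N h g + parseval_defect N k g"
proof -
  have "sine_coeff (\<lambda>u. h u + k u) n = sine_coeff h n + sine_coeff k n" for n
    unfolding sine_coeff_ip by (intro ip_add assms continuous_intros)
  then show ?thesis
    by (simp add: parseval_defect_def ip_add assms sum.distrib algebra_simps)
qed

lemma parseval_defect_scale: "parseval_defect N (\<lambda>u. c * h u) g = c * parseval_defect N h g"
  unfolding parseval_defect_def sine_coeff_ip ip_scale
  by (simp add: algebra_simps sum_distrib_left)

lemma parseval_defect_sin:
  assumes "1 \<le> n" "n \<le> N"
  shows "parseval_defect N (\<lambda>u. sin (real n * u)) g = 0"
proof -
  have "(\<Sum>k<N. sine_coeff (\<lambda>u. sin (real n * u)) (Suc k) * sine_coeff g (Suc k))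
      = (\<Sum>k<N. if k = n - 1 then pi / 2 * sine_coeff g n else 0)"
    using assms by (intro sum.cong) (auto simp: sine_coeff_sin simp del: of_nat_Suc)
  also have "\<dots> = pi / 2 * sine_coeff g n"
    using assms by (subst sum.delta) auto
  finally show ?thesis
    by (simp add: parseval_defect_def sine_coeff_def ip_def mult.commute field_simps)
qed

lemma parseval_defect_nonneg:
  assumes h: "continuous_on {0..pi} h"
  shows "parseval_defect N h h \<ge> 0"
proof -
  define c where "c k = - (2 / pi * sine_coeff h (Suc k))" for k
  \<comment> \<open>Minus the orthogonal projection of \<open>h\<close>, so that the goal is that \<open>h + P\<close> has nonnegative square.\<close>
  define P where "P = (\<lambda>u. \<Sum>k<N. c k * sin (real (Suc k) * u))"
  have P: "continuous_on {0..pi} P" unfolding P_def by (intro continuous_intros)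
  have ipP: "ip P g = (\<Sum>k<N. c k * sine_coeff g (Suc k))" if "continuous_on {0..pi} g" for g
    unfolding P_def using that
    by (subst ip_sum) (auto simp: sine_coeff_ip ip_commute intro!: continuous_intros)
  have cP: "sine_coeff P (Suc j) = - sine_coeff h (Suc j)" if "j < N" for j
  proof -
    have "sine_coeff P (Suc j) = (\<Sum>k<N. c k * (if j = k then pi / 2 else 0))"
      unfolding sine_coeff_ip 
      by (subst ipP) (auto intro!: continuous_intros sum.cong simp: sine_coeff_sin simp del: of_nat_Suc)
    also have "\<dots> = (\<Sum>k<N. if k = j then - sine_coeff h (Suc j) else 0)"
      by (intro sum.cong) (auto simp: c_def)
    finally show ?thesis using that by (simp add: sum.delta)
  qed
  have "0 \<le> ip (\<lambda>u. h u + P u) (\<lambda>u. h u + P u)" by (rule ip_self_nonneg)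
  also have "\<dots> = ip h (\<lambda>u. h u + P u) + ip P (\<lambda>u. h u + P u)"
    by (intro ip_add h P continuous_intros)
  also have "\<dots> = ip h h + ip P h + (ip P h + ip P P)"
    by (simp add: ip_commute[of _ "\<lambda>u. h u + P u"] ip_add h P ip_commute[of h P])
  also have "ip P P = (\<Sum>k<N. - (c k * sine_coeff h (Suc k)))"
    by (subst ipP) (auto simp: P cP)
  also have "\<dots> = - ip P h" by (simp add: ipP h sum_negf)
  finally show ?thesis
    by (simp add: ipP[OF h] parseval_defect_def c_def sum_distrib_left sum_negf mult_ac)
qed

lemma parseval_defect_le: "parseval_defect N h h \<le> ip h h"
proof -
  have "0 \<le> 2 / pi * (\<Sum>k<N. sine_coeff h (Suc k) * sine_coeff h (Suc k))"
    by (intro mult_nonneg_nonneg[of "2 / pi"] sum_nonneg zero_le_square) simp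
  then show ?thesis by (simp add: parseval_defect_def)
qed

text \<open>
  Finite linear combinations of the functions \<open>sin (n u)\<close>. Given as a closure, so that
  properties of the span follow by rule induction.
\<close>

inductive sine_poly :: "(real \<Rightarrow> real) \<Rightarrow> bool" where
  sin: "sine_poly (\<lambda>u. sin (real n * u))"
| add: "sine_poly p \<Longrightarrow> sine_poly q \<Longrightarrow> sine_poly (\<lambda>u. p u + q u)"
| scale: "sine_poly p \<Longrightarrow> sine_poly (\<lambda>u. c * p u)"

lemma sine_poly_continuous: "sine_poly p \<Longrightarrow> continuous_on A p"
  by (induction rule: sine_poly.induct) (auto intro!: continuous_intros)

lemma sine_poly_zero: "sine_poly (\<lambda>u. 0)"
  using sine_poly.sin[of 0] by simp

lemma sine_poly_sum: "(\<And>i. i \<in> A \<Longrightarrow> sine_poly (p i)) \<Longrightarrow> sine_poly (\<lambda>u. \<Sum>i\<in>A. p i u)"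
  by (induction A rule: infinite_finite_induct) (auto intro: sine_poly_zero sine_poly.add)

lemma sine_poly_times_cos: "sine_poly p \<Longrightarrow> sine_poly (\<lambda>u. cos u * p u)"
proof (induction rule: sine_poly.induct)
  case (sin n)
  show ?case
  proof (cases n)
    case 0
    then show ?thesis by (simp add: sine_poly_zero)
  next
    case (Suc m)
    have "cos u * sin (real n * u) = 1/2 * (sin (real (n + 1) * u) + sin (real m * u))" for u
      using sin_times_cos[of "real n * u" u]
      by (simp add: Suc algebra_simps)
    then show ?thesis
      by (simp only: sine_poly.scale sine_poly.add sine_poly.sin)
  qed
next
  case (add p q)
  then show ?case using sine_poly.add by (simp add: distrib_left)
next
  case (scale p c)
  then show ?case using sine_poly.scale[of _ c] by (simp add: mult.left_commute)
qed

lemma sine_poly_sin_times_cos_power: "sine_poly (\<lambda>u. sin u * cos u ^ j)"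
proof (induction j)
  case 0 show ?case using sine_poly.sin[of 1] by simp
next
  case (Suc j) then show ?case using sine_poly_times_cos[OF Suc] by (simp add: mult_ac)
qed

lemma parseval_defect_sine_poly:
  assumes "sine_poly T"
  shows "\<exists>N0. \<forall>N\<ge>N0. \<forall>g. continuous_on {0..pi} g \<longrightarrow> parseval_defect N T g = 0"
  using assms
proof (induction rule: sine_poly.induct)
  case (sin n)
  show ?case
  proof (cases "n = 0")
    case True
    then show ?thesis using parseval_defect_scale[of _ 0 "\<lambda>_. 0"] by simp
  next
    case False
    then show ?thesis by (intro exI[of _ n]) (auto simp: parseval_defect_sin)
  qed
next
  case (add p q)
  then obtain N1 N2 where 
    "\<forall>N\<ge>N1. \<forall>g. continuous_on {0..pi} g \<longrightarrow> parseval_defect N p g = 0"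
    "\<forall>N\<ge>N2. \<forall>g. continuous_on {0..pi} g \<longrightarrow> parseval_defect N q g = 0" by blast
  then show ?case using add.hyps
    by (intro exI[of _ "max N1 N2"]) (auto simp: parseval_defect_add sine_poly_continuous)
next
  case (scale p c)
  then show ?case by (auto simp: parseval_defect_scale)
qed

text \<open>
  Sine polynomials are dense in mean square. For small \<open>d\<close> the function
  \<open>h sin\<^sup>2 / (sin\<^sup>2 + d)\<close> is close to \<open>h\<close> in mean square by dominated convergence, and it has the form
  \<open>sin u * q (cos u)\<close> with \<open>q\<close> continuous on \<open>[-1, 1]\<close>. Approximating \<open>q\<close> uniformly by a polynomial
  gives a sine polynomial.
\<close>

lemma sine_poly_dense:
  assumes h: "continuous_on {0..pi} h" and e: "e > 0"
  shows "\<exists>T. sine_poly T \<and> ip (\<lambda>u. h u - T u) (\<lambda>u. h u - T u) < e"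
proof -
  define hd where "hd d u = h u * (sin u)\<^sup>2 / ((sin u)\<^sup>2 + d)" for d u
  define r where "r n u = (h u - hd (1 / real (Suc n)) u)\<^sup>2" for n u
  have pos: "(sin u)\<^sup>2 + d > 0" if "d > 0" for u d :: real
    using that by (simp add: add_nonneg_pos)
  have conthd: "continuous_on {0..pi} (hd d)" if "d > 0" for d
    unfolding hd_def using pos[OF that] by (intro continuous_intros h) (auto simp: less_le)
  have bd: "\<bar>hd d u\<bar> \<le> \<bar>h u\<bar>" if "d > 0" for d u
  proof -
    have "(sin u)\<^sup>2 / ((sin u)\<^sup>2 + d) \<le> 1" using pos[OF that, of u] that by simp
    then have "\<bar>h u\<bar> * ((sin u)\<^sup>2 / ((sin u)\<^sup>2 + d)) \<le> \<bar>h u\<bar> * 1" 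
      by (intro mult_left_mono) auto
    then show ?thesis unfolding hd_def using pos[OF that, of u] by (simp add: abs_mult)
  qed
  \<comment> \<open>The integrands do not tend to 0 at the end points, hence the open interval.\<close>
  have "(\<lambda>n. integral {0<..<pi} (r n)) \<longlonglongrightarrow> integral {0<..<pi} (\<lambda>u. 0)"
  proof (rule dominated_convergence(2))
    show "r n integrable_on {0<..<pi}" for n
      unfolding r_def integrable_on_open_interval_real
      by (intro integrable_continuous_interval continuous_intros h conthd) auto
    show "(\<lambda>u. (2 * h u)\<^sup>2) integrable_on {0<..<pi}"
      unfolding integrable_on_open_interval_real
      by (intro integrable_continuous_interval continuous_intros h)
    show "norm (r n u) \<le> (2 * h u)\<^sup>2" for n u
    proof -
      have "\<bar>h u - hd (1 / real (Suc n)) u\<bar> \<le> \<bar>2 * h u\<bar>" 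
        using bd[of "1 / real (Suc n)" u] by simp
      then show ?thesis unfolding r_def by (simp add: abs_le_square_iff)
    qed
    show "(\<lambda>n. r n u) \<longlonglongrightarrow> 0" if "u \<in> {0<..<pi}" for u
    proof -
      have "sin u > 0" using that by (simp add: sin_gt_zero)
      have "(\<lambda>n. 1 / real (Suc n)) \<longlonglongrightarrow> 0"
        using LIMSEQ_inverse_real_of_nat by (simp add: inverse_eq_divide)
      then have "(\<lambda>n. r n u) \<longlonglongrightarrow> (h u - h u * (sin u)\<^sup>2 / ((sin u)\<^sup>2 + 0))\<^sup>2"
        unfolding r_def hd_def using \<open>sin u > 0\<close> by (intro tendsto_intros) auto
      then show ?thesis using \<open>sin u > 0\<close> by simp
    qed
  qed
  then have "(\<lambda>n. integral {0..pi} (r n)) \<longlonglongrightarrow> 0"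
    by (simp add: integral_open_interval_real)
  then have "eventually (\<lambda>n. integral {0..pi} (r n) < e / 4) sequentially"
    using e by (intro order_tendstoD) auto
  then obtain n where n: "integral {0..pi} (r n) < e / 4" by (auto simp: eventually_sequentially)
  define d where "d = 1 / real (Suc n)"
  have d: "d > 0" by (simp add: d_def)
  define q where "q t = h (arccos t) * sin (arccos t) / ((sin (arccos t))\<^sup>2 + d)" for t
  have q: "continuous_on {-1..1} q"
  proof -
    have "continuous_on {-1..1} (\<lambda>t. h (arccos t))"
      by (rule continuous_on_compose2[OF h continuous_on_arccos']) 
         (auto intro: arccos_lbound arccos_ubound)
    then show ?thesis unfolding q_def using pos[OF d] continuous_on_arccos'
      by (intro continuous_intros) (auto simp: less_le)
  qed
  have "sqrt (e / 16) > 0" using e by simp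
  then obtain p where p: "real_polynomial_function p" "\<And>t. t \<in> {-1..1} \<Longrightarrow> \<bar>q t - p t\<bar> < sqrt (e / 16)"
    using Stone_Weierstrass_real_polynomial_function[OF compact_Icc q] by metis
  from p(1) obtain a and m::nat where a: "p = (\<lambda>x. \<Sum>i\<le>m. a i * x ^ i)"
    unfolding real_polynomial_function_iff_sum by blast
  define T where "T u = sin u * p (cos u)" for u
  have T: "sine_poly T"
  proof -
    have "T = (\<lambda>u. \<Sum>i\<le>m. a i * (sin u * cos u ^ i))"
      by (simp add: fun_eq_iff T_def a sum_distrib_left mult_ac)
    then show ?thesis
      by (simp add: sine_poly_sum sine_poly.scale sine_poly_sin_times_cos_power)
  qed
  have hdT: "(hd d u - T u)\<^sup>2 \<le> e / 16" if "u \<in> {0..pi}" for u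
  proof -
    have "hd d u - T u = sin u * (q (cos u) - p (cos u))"
      using that by (simp add: hd_def T_def q_def arccos_cos right_diff_distrib power2_eq_square mult_ac)
    then have "\<bar>hd d u - T u\<bar> = \<bar>sin u\<bar> * \<bar>q (cos u) - p (cos u)\<bar>" by (simp add: abs_mult)
    also have "\<dots> \<le> 1 * sqrt (e / 16)"
      using p(2)[of "cos u"] by (intro mult_mono) auto
    finally have "\<bar>hd d u - T u\<bar> \<le> sqrt (e / 16)" by simp
    then have "\<bar>hd d u - T u\<bar>\<^sup>2 \<le> (sqrt (e / 16))\<^sup>2" by (intro power_mono) auto
    then show ?thesis using e by simp
  qed
  have "ip (\<lambda>u. h u - T u) (\<lambda>u. h u - T u) \<le> integral {0..pi} (\<lambda>u. 2 * r n u + 2 * (e / 16))"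
    unfolding ip_def
  proof (rule integral_le)
    show "(\<lambda>u. (h u - T u) * (h u - T u)) integrable_on {0..pi}"
      by (intro integrable_continuous_interval continuous_intros h sine_poly_continuous T)
    show "(\<lambda>u. 2 * r n u + 2 * (e / 16)) integrable_on {0..pi}"
      unfolding r_def by (intro integrable_continuous_interval continuous_intros h conthd) auto
    fix u assume u: "u \<in> {0..pi}"
    have "(h u - T u) * (h u - T u) \<le> 2 * (h u - hd d u)\<^sup>2 + 2 * (hd d u - T u)\<^sup>2"
      using sum_squares_ge_zero[of "(h u - hd d u) - (hd d u - T u)" 0] 
      by (simp add: power2_eq_square algebra_simps)
    then show "(h u - T u) * (h u - T u) \<le> 2 * r n u + 2 * (e / 16)"
      using hdT[OF u] unfolding r_def d_def by linarith
  qed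
  also have "\<dots> = 2 * integral {0..pi} (r n) + pi * (2 * (e / 16))"
  proof -
    have "r n integrable_on {0..pi}"
      unfolding r_def by (intro integrable_continuous_interval continuous_intros h conthd) auto
    then have "integral {0..pi} (\<lambda>u. 2 * r n u + 2 * (e / 16)) 
       = integral {0..pi} (\<lambda>u. 2 * r n u) + integral {0..pi} (\<lambda>u. 2 * (e / 16))"
      by (intro integral_add integrable_on_cmult_left) auto
    then show ?thesis by simp
  qed
  also have "\<dots> < e"
    using n mult_strict_right_mono[OF pi_less_4 e] by simp
  finally show ?thesis using T by blast
qed

theorem parseval_sine:
  assumes h: "continuous_on {0..pi} h" and g: "continuous_on {0..pi} g"
  shows "(\<lambda>k. sine_coeff h (Suc k) * sine_coeff g (Suc k)) sums (pi / 2 * integral {0..pi} (\<lambda>u. h u * g u))"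
proof -
  define G where "G = 1 + ip g g"
  have G: "G > 0" using ip_self_nonneg[of g] by (simp add: G_def)
  have "(\<lambda>N. parseval_defect N h g) \<longlonglongrightarrow> 0"
  proof (rule LIMSEQ_I)
    fix \<epsilon> :: real assume "\<epsilon> > 0"
    define t where "t = \<epsilon> / G"
    have t: "t > 0" using G \<open>\<epsilon> > 0\<close> by (simp add: t_def)
    obtain T where T: "sine_poly T" "ip (\<lambda>u. h u - T u) (\<lambda>u. h u - T u) < t\<^sup>2"
      using sine_poly_dense[OF h, of "t\<^sup>2"] t by auto
    obtain N0 where N0: "\<And>N k. N \<ge> N0 \<Longrightarrow> continuous_on {0..pi} k \<Longrightarrow> parseval_defect N T k = 0"
      using parseval_defect_sine_poly[OF T(1)] by blast
    define r where "r u = h u - T u" for u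
    have r: "continuous_on {0..pi} r" 
      unfolding r_def by (intro continuous_intros h sine_poly_continuous T)
    have "norm (parseval_defect N h g - 0) < \<epsilon>" if N: "N \<ge> N0" for N
    proof -
      let ?D = "parseval_defect N"
      have "?D h g = ?D (\<lambda>u. r u + T u) g" by (simp add: r_def)
      also have "\<dots> = ?D r g"
        using N0[OF N g] by (simp add: parseval_defect_add r g sine_poly_continuous T)
      finally have eq: "?D h g = ?D r g" .
      have rr: "?D r r < t\<^sup>2" using T(2) parseval_defect_le[of N r] by (simp add: r_def[abs_def])
      have gg: "?D g g \<le> G - 1" using parseval_defect_le[of N g] by (simp add: G_def)
      \<comment> \<open>Positivity along the line through \<open>r\<close> and \<open>g\<close> replaces the Cauchy-Schwarz inequality.\<close>
      have quad: "0 \<le> ?D r r + 2 * s * ?D r g + s\<^sup>2 * ?D g g" for s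
      proof -
        have c: "continuous_on {0..pi} (\<lambda>u. s * g u)" "continuous_on {0..pi} (\<lambda>u. r u + s * g u)" 
          by (intro continuous_intros g r)+
        have "0 \<le> ?D (\<lambda>u. r u + s * g u) (\<lambda>u. r u + s * g u)" using c by (rule_tac parseval_defect_nonneg)
        also have "\<dots> = ?D r (\<lambda>u. r u + s * g u) + s * ?D g (\<lambda>u. r u + s * g u)"
          using c r g by (simp add: parseval_defect_add parseval_defect_scale)
        also have "\<dots> = ?D r r + 2 * s * ?D r g + s\<^sup>2 * ?D g g"
          using c r g
          by (simp add: parseval_defect_commute[of N _ "\<lambda>u. r u + s * g u"] parseval_defect_add 
             parseval_defect_scale parseval_defect_commute[of N g r] power2_eq_square algebra_simps)
        finally show ?thesis .
      qed
      have "t\<^sup>2 * ?D g g \<le> t\<^sup>2 * (G - 1)" using gg by (intro mult_left_mono) auto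
      then have "0 < t\<^sup>2 + 2 * t * ?D r g + t\<^sup>2 * (G - 1)" "0 < t\<^sup>2 - 2 * t * ?D r g + t\<^sup>2 * (G - 1)"
        using quad[of t] quad[of "-t"] rr by simp_all
      then have "0 < t * (t * G + 2 * ?D r g)" "0 < t * (t * G - 2 * ?D r g)"
        by (simp_all add: power2_eq_square algebra_simps)
      then have "\<bar>?D r g\<bar> < t * G" using t by (simp add: zero_less_mult_iff)
      then show ?thesis using G by (simp add: eq t_def)
    qed
    then show "\<exists>N0. \<forall>N\<ge>N0. norm (parseval_defect N h g - 0) < \<epsilon>" by blast
  qed
  then have "(\<lambda>N. pi / 2 * (ip h g - parseval_defect N h g)) \<longlonglongrightarrow> pi / 2 * (ip h g - 0)"
    by (intro tendsto_intros)
  then show ?thesis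
    by (simp add: sums_def parseval_defect_def ip_def)
qed

section \<open>The cosine transform of the reciprocal of cosh u + cosh v\<close>

text \<open>
  The partial fraction series of the hyperbolic cosecant is Parseval's identity
  for \<open>sinh (c u)\<close> and \<open>\<pi> - u\<close>.
\<close>

lemma sums_alternating_csch:
  fixes c :: real
  assumes "c > 0"
  shows "(\<lambda>k. (-1) ^ k / ((real (Suc k))\<^sup>2 + c\<^sup>2)) sums (1 / (2 * c\<^sup>2) - pi / (2 * c * sinh (pi * c)))"
proof -
  have pos: "x\<^sup>2 + c\<^sup>2 > 0" for x using assms by (simp add: add_nonneg_pos)
  have 1: "sine_coeff (\<lambda>u. sinh (c * u)) (Suc k) = (-1) ^ k * (real (Suc k) * sinh (pi * c) / ((real (Suc k))\<^sup>2 + c\<^sup>2))" for k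
  proof -
    define n where "n = real (Suc k)"
    have cos: "cos (n * pi) = - ((-1) ^ k)" unfolding n_def by (metis cos_npi power_Suc mult_minus1)
    have sin: "sin (n * pi) = 0" unfolding n_def by (rule sin_npi)
    define F where "F u = (c * cosh (c * u) * sin (n * u) - n * sinh (c * u) * cos (n * u)) / (n\<^sup>2 + c\<^sup>2)" for u
    have "(F has_real_derivative sinh (c * u) * sin (n * u)) (at u within {0..pi})" for u
    proof -
      have "((\<lambda>u. c * cosh (c * u) * sin (n * u) - n * sinh (c * u) * cos (n * u)) has_real_derivative
          sinh (c * u) * sin (n * u) * (n\<^sup>2 + c\<^sup>2)) (at u within {0..pi})"
        by (auto intro!: derivative_eq_intros simp: algebra_simps power2_eq_square)
      from DERIV_cdivide[OF this, of "n\<^sup>2 + c\<^sup>2"]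
      show ?thesis using pos[of n] assms unfolding F_def by simp
    qed
    then have "((\<lambda>u. sinh (c * u) * sin (n * u)) has_integral (F pi - F 0)) {0..pi}"
      by (intro fundamental_theorem_of_calculus) (auto simp flip: has_real_derivative_iff_has_vector_derivative)
    then have "sine_coeff (\<lambda>u. sinh (c * u)) (Suc k) = F pi - F 0"
      unfolding sine_coeff_def n_def by (rule integral_unique)
    then show ?thesis unfolding F_def using cos sin by (simp add: n_def[symmetric] mult_ac del: of_nat_Suc)
  qed
  have 2: "sine_coeff (\<lambda>u. pi - u) (Suc k) = pi / real (Suc k)" for k
  proof -
    define n where "n = real (Suc k)"
    have n: "n \<noteq> 0" by (simp add: n_def)
    have sin: "sin (n * pi) = 0" unfolding n_def by (rule sin_npi)
    define F where "F u = - ((pi - u) * cos (n * u) / n) - sin (n * u) / n\<^sup>2" for u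
    have "(F has_real_derivative (pi - u) * sin (n * u)) (at u within {0..pi})" for u
      unfolding F_def using n
      by (auto intro!: derivative_eq_intros simp: field_simps power2_eq_square)
    then have "((\<lambda>u. (pi - u) * sin (n * u)) has_integral (F pi - F 0)) {0..pi}"
      by (intro fundamental_theorem_of_calculus) (auto simp flip: has_real_derivative_iff_has_vector_derivative)
    then have "sine_coeff (\<lambda>u. pi - u) (Suc k) = F pi - F 0"
      unfolding sine_coeff_def n_def by (rule integral_unique)
    then show ?thesis unfolding F_def using sin by (simp add: n_def)
  qed
  have 3: "integral {0..pi} (\<lambda>u. sinh (c * u) * (pi - u)) = sinh (pi * c) / c\<^sup>2 - pi / c"
  proof -
    define F where "F u = (pi - u) * cosh (c * u) / c + sinh (c * u) / c\<^sup>2" for u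
    have "(F has_real_derivative sinh (c * u) * (pi - u)) (at u within {0..pi})" for u
      unfolding F_def using assms
      by (auto intro!: derivative_eq_intros simp: field_simps power2_eq_square)
    then have "((\<lambda>u. sinh (c * u) * (pi - u)) has_integral (F pi - F 0)) {0..pi}"
      by (intro fundamental_theorem_of_calculus) (auto simp flip: has_real_derivative_iff_has_vector_derivative)
    then have "integral {0..pi} (\<lambda>u. sinh (c * u) * (pi - u)) = F pi - F 0"
      by (rule integral_unique)
    then show ?thesis by (simp add: F_def mult_ac)
  qed
  have s: "sinh (pi * c) > 0" using assms by simp
  have "(\<lambda>k. (1 / (pi * sinh (pi * c))) * (sine_coeff (\<lambda>u. sinh (c * u)) (Suc k) * sine_coeff (\<lambda>u. pi - u) (Suc k)))
     sums ((1 / (pi * sinh (pi * c))) * (pi / 2 * (sinh (pi * c) / c\<^sup>2 - pi / c)))"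
    unfolding 3[symmetric] by (intro sums_mult parseval_sine continuous_intros)
  moreover have "(1 / (pi * sinh (pi * c))) * (sine_coeff (\<lambda>u. sinh (c * u)) (Suc k) * sine_coeff (\<lambda>u. pi - u) (Suc k))
      = (-1) ^ k / ((real (Suc k))\<^sup>2 + c\<^sup>2)" for k
    unfolding 1 2 using s assms by (simp add: field_simps del: of_nat_Suc)
  moreover have "(1 / (pi * sinh (pi * c))) * (pi / 2 * (sinh (pi * c) / c\<^sup>2 - pi / c)) = 1 / (2 * c\<^sup>2) - pi / (2 * c * sinh (pi * c))"
    using s assms by (simp add: field_simps)
  ultimately show ?thesis by simp
qed

text \<open>
  Lebesgue measure on the open half line \<open>(0, \<infinity>)\<close>. As a density on the whole line it has the Borel
  sets of the reals as measurable sets, so no restricted \<open>\<sigma>\<close>-algebra enters the uses of Fubini's theorem.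
\<close>

definition hl :: "real measure" where
  "hl = density lborel (indicator {0<..})"

lemma borel_measurable_cosh_real [measurable]: "(cosh :: real \<Rightarrow> real) \<in> borel_measurable borel"
  and borel_measurable_sinh_real [measurable]: "(sinh :: real \<Rightarrow> real) \<in> borel_measurable borel"
  by (intro borel_measurable_continuous_onI continuous_intros)+

lemma sets_hl [measurable_cong, simp]: "sets hl = sets borel"
  and space_hl [simp]: "space hl = UNIV"
  by (simp_all add: hl_def)

lemma sigma_finite_hl: "sigma_finite_measure hl"
  unfolding hl_def
  by (subst sigma_finite_measure.sigma_finite_iff_density_finite)
     (auto simp: lborel.sigma_finite_measure_axioms indicator_def)

interpretation hl: sigma_finite_measure hl by (rule sigma_finite_hl)
interpretation hl_hl: pair_sigma_finite hl hl ..
interpretation hl_lborel: pair_sigma_finite hl lborel ..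

lemma AE_hl: "(AE x in hl. P x) \<longleftrightarrow> (AE x in lborel. 0 < x \<longrightarrow> P x)"
  unfolding hl_def by (subst AE_density) (auto simp: indicator_def)

lemma AE_hlI: "(\<And>x. 0 < x \<Longrightarrow> P x) \<Longrightarrow> AE x in hl. P x"
  by (simp add: AE_hl)

lemma integral_hl_cong:
  "(\<And>x. 0 < x \<Longrightarrow> f x = g x) \<Longrightarrow> f \<in> borel_measurable borel \<Longrightarrow> g \<in> borel_measurable borel \<Longrightarrow>
   integral\<^sup>L hl f = integral\<^sup>L hl g"
  by (intro integral_cong_AE) (auto intro: AE_hlI)

lemma
  fixes f :: "real \<Rightarrow> 'a :: {banach, second_countable_topology}"
  assumes [measurable]: "f \<in> borel_measurable borel"
  shows integrable_hl_iff: "integrable hl f \<longleftrightarrow> set_integrable lborel {0<..} f"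
    and integral_hl: "integral\<^sup>L hl f = (LINT x:{0<..}|lborel. f x)"
proof -
  have eq: "hl = density lborel (\<lambda>x. ennreal (indicator {0<..} x))"
    by (simp add: hl_def ennreal_indicator)
  show "integrable hl f \<longleftrightarrow> set_integrable lborel {0<..} f"
    unfolding eq set_integrable_def by (rule integrable_density) auto
  show "integral\<^sup>L hl f = (LINT x:{0<..}|lborel. f x)"
    unfolding eq set_lebesgue_integral_def by (rule integral_density) auto
qed

lemma hl_integrable_dominated:
  fixes f :: "real \<Rightarrow> 'a :: {banach, second_countable_topology}"
  assumes "integrable hl g" "f \<in> borel_measurable borel" "\<And>x. 0 < x \<Longrightarrow> norm (f x) \<le> g x"
  shows "integrable hl f"
proof (rule Bochner_Integration.integrable_bound[OF assms(1)])
  show "f \<in> borel_measurable hl" using assms(2) by simp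
  show "AE x in hl. norm (f x) \<le> norm (g x)"
    using assms(3) by (intro AE_hlI) (smt (verit) real_norm_def)
qed

text \<open>
  The fundamental theorem of calculus on the half line; for nonnegative \<open>f\<close>, existence of the
  limits of \<open>F\<close> also gives integrability.
\<close>

lemma
  fixes f F :: "real \<Rightarrow> real"
  assumes f: "f \<in> borel_measurable borel" 
    and F: "\<And>x. 0 < x \<Longrightarrow> (F has_real_derivative f x) (at x)" "\<And>x. 0 < x \<Longrightarrow> isCont f x"
    and lim: "(F \<longlongrightarrow> A) (at_right 0)" "(F \<longlongrightarrow> B) at_top"
  shows hl_FTC: "integrable hl f \<Longrightarrow> integral\<^sup>L hl f = B - A"
    and hl_FTC_nonneg: "(\<And>x. 0 < x \<Longrightarrow> 0 \<le> f x) \<Longrightarrow> integrable hl f"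
proof -
  have lim': "((F \<circ> real_of_ereal) \<longlongrightarrow> A) (at_right 0)" "((F \<circ> real_of_ereal) \<longlongrightarrow> B) (at_left \<infinity>)"
    using lim unfolding zero_ereal_def by (simp_all add: ereal_tendsto_simps1)
  have ei: "einterval 0 \<infinity> = {0<..}" by (auto simp: einterval_def)
  show "integral\<^sup>L hl f = B - A" if "integrable hl f"
  proof -
    have "(LBINT x=0..\<infinity>. f x) = B - A"
      by (rule interval_integral_FTC_integrable[where F = F])
         (use F lim' that f in \<open>auto simp: ei integrable_hl_iff has_real_derivative_iff_has_vector_derivative\<close>)
    then show ?thesis using f by (simp add: integral_hl interval_lebesgue_integral_def ei)
  qed
  show "integrable hl f" if nn: "\<And>x. 0 < x \<Longrightarrow> 0 \<le> f x"
  proof -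
    have "set_integrable lborel (einterval 0 \<infinity>) f"
      by (rule interval_integral_FTC_nonneg(1)[where F = F and A = A and B = B])
         (use F lim' nn in auto)
    then show ?thesis using f by (simp add: ei integrable_hl_iff)
  qed
qed

lemma
  assumes "k > 0"
  shows integrable_hl_exp: "integrable hl (\<lambda>w. exp (- (k * w)))"
    and integral_hl_exp: "integral\<^sup>L hl (\<lambda>w. exp (- (k * w))) = 1 / k"
proof -
  have D: "((\<lambda>w. - exp (- (k * w)) / k) has_real_derivative exp (- (k * x))) (at x)" for x
    using assms by (auto intro!: derivative_eq_intros)
  have "filterlim (\<lambda>w. k * w) at_top at_top"
    using assms by (intro filterlim_tendsto_pos_mult_at_top[OF tendsto_const] filterlim_ident) 
  then have t: "((\<lambda>w. - exp (- (k * w)) / k) \<longlongrightarrow> - 0 / k) at_top"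
    using assms by (intro tendsto_intros filterlim_compose[OF exp_at_bot] filterlim_compose[OF filterlim_uminus_at_bot_at_top]) auto
  have l: "((\<lambda>w. - exp (- (k * w)) / k) \<longlongrightarrow> - exp (- (k * 0)) / k) (at_right 0)"
    using assms by (intro tendsto_intros) auto
  show i: "integrable hl (\<lambda>w. exp (- (k * w)))"
    by (rule hl_FTC_nonneg[OF _ D _ l t]) auto
  show "integral\<^sup>L hl (\<lambda>w. exp (- (k * w))) = 1 / k"
    using hl_FTC[OF _ D _ l t i] by simp
qed

lemma integral_hl_exp_sin:
  assumes "k > 0"
  shows "integral\<^sup>L hl (\<lambda>w. exp (- (k * w)) * sin (c * w)) = c / (k\<^sup>2 + c\<^sup>2)"
proof -
  have pos: "k\<^sup>2 + c\<^sup>2 > 0" using assms by (simp add: add_pos_nonneg)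
  let ?F = "\<lambda>w. - (exp (- (k * w)) * (k * sin (c * w) + c * cos (c * w))) / (k\<^sup>2 + c\<^sup>2)"
  have D: "(?F has_real_derivative exp (- (k * x)) * sin (c * x)) (at x)" for x
  proof -
    have "((\<lambda>w. exp (- (k * w)) * (k * sin (c * w) + c * cos (c * w))) has_real_derivative 
      - (exp (- (k * x)) * sin (c * x) * (k\<^sup>2 + c\<^sup>2))) (at x)"
      by (auto intro!: derivative_eq_intros simp: algebra_simps power2_eq_square)
    from DERIV_cdivide[OF DERIV_minus[OF this], of "k\<^sup>2 + c\<^sup>2"]
    show ?thesis using pos assms by simp
  qed
  have "filterlim (\<lambda>w. k * w) at_top at_top"
    using assms by (intro filterlim_tendsto_pos_mult_at_top[OF tendsto_const] filterlim_ident) 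
  then have "((\<lambda>w. exp (- (k * w))) \<longlongrightarrow> 0) at_top"
    by (intro filterlim_compose[OF exp_at_bot] filterlim_compose[OF filterlim_uminus_at_bot_at_top]) auto
  then have "((\<lambda>w. exp (- (k * w)) * (k * sin (c * w) + c * cos (c * w))) \<longlongrightarrow> 0) at_top"
  proof (rule lim_null_mult_right_bounded)
    show "\<forall>\<^sub>F w in at_top. norm (k * sin (c * w) + c * cos (c * w)) \<le> k + \<bar>c\<bar>"
    proof (intro always_eventually allI)
      fix w
      have "\<bar>k * sin (c * w)\<bar> \<le> k * 1" "\<bar>c * cos (c * w)\<bar> \<le> \<bar>c\<bar> * 1"
        using assms unfolding abs_mult by (intro mult_mono; simp)+
      then show "norm (k * sin (c * w) + c * cos (c * w)) \<le> k + \<bar>c\<bar>" by (simp add: abs_le_iff)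
    qed
  qed
  then have t: "(?F \<longlongrightarrow> - 0 / (k\<^sup>2 + c\<^sup>2)) at_top"
    using pos by (intro tendsto_divide tendsto_minus tendsto_const) auto
  have l: "(?F \<longlongrightarrow> - (exp (- (k * 0)) * (k * sin (c * 0) + c * cos (c * 0))) / (k\<^sup>2 + c\<^sup>2)) (at_right 0)"
    using pos by (intro tendsto_intros) auto
  have i: "integrable hl (\<lambda>w. exp (- (k * w)) * sin (c * w))"
    by (rule hl_integrable_dominated[OF integrable_hl_exp[OF assms]]) (auto simp: abs_mult)
  show ?thesis
    using hl_FTC[OF _ D _ l t i] by simp
qed

text \<open>
  Twice the Fermi function, that is \<open>1 - tanh (w / 2)\<close>.
\<close>

definition fermi :: "real \<Rightarrow> real" where "fermi w = 2 / (exp w + 1)"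

lemma fermi_bounds: "0 < fermi w" "fermi w \<le> 2 * exp (- w)"
proof -
  have "exp w > 0" by simp
  then show "0 < fermi w" "fermi w \<le> 2 * exp (- w)"
    by (simp_all add: fermi_def exp_minus field_simps del: exp_gt_zero)
qed

lemma fermi_measurable [measurable]: "fermi \<in> borel_measurable borel"
  unfolding fermi_def by measurable

lemma integrable_hl_fermi: "integrable hl fermi"
proof (rule hl_integrable_dominated)
  show "integrable hl (\<lambda>w. 2 * exp (- (1 * w)))" 
    by (intro integrable_mult_right integrable_hl_exp) auto
qed (use fermi_bounds in \<open>auto simp: less_imp_le\<close>)

text \<open>
  Expanding \<open>fermi\<close> into a geometric series in \<open>exp (- w)\<close> and integrating term by term gives the
  partial fraction series of the hyperbolic cosecant. The remainder of the finite geometric sum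
  is explicit, so no limit has to be exchanged with the integral.
\<close>

lemma integral_hl_fermi_sin:
  assumes "c > 0"
  shows "integral\<^sup>L hl (\<lambda>w. fermi w * sin (c * w)) = 1 / c - pi / sinh (pi * c)"
proof -
  let ?I = "integral\<^sup>L hl (\<lambda>w. fermi w * sin (c * w))"
  have i1: "integrable hl (\<lambda>w. fermi w * sin (c * w))"
    by (rule hl_integrable_dominated[OF integrable_hl_fermi]) 
       (use fermi_bounds in \<open>auto simp: abs_mult mult_left_le less_imp_le\<close>)
  have ie: "integrable hl (\<lambda>w. exp (- (real (Suc k) * w)) * sin (c * w))" for k
    by (rule hl_integrable_dominated[OF integrable_hl_exp[of "real (Suc k)"]]) (auto simp: abs_mult)
  have alg: "fermi w = 2 * (\<Sum>k<N. (-1)^k * exp (- (real (Suc k) * w))) + (-1)^N * exp (- (real N * w)) * fermi w" for N w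
  proof (induction N)
    case (Suc N)
    have E: "exp (- (real (Suc N) * w)) = exp (- (real N * w)) * exp (-w)"
      by (simp add: exp_add[symmetric] algebra_simps)
    have "fermi w = 2 * exp (-w) - exp (-w) * fermi w"
    proof -
      have "2 / (X + 1) = 2 * inverse X - inverse X * (2 / (X + 1))" if "X > 0" for X :: real
        using that by (simp add: divide_simps)
      from this[OF exp_gt_zero] show ?thesis unfolding fermi_def exp_minus .
    qed
    then have "(-1)^N * exp (- (real N * w)) * fermi w = (-1)^N * exp (- (real N * w)) * (2 * exp (-w) - exp (-w) * fermi w)"
      by simp
    then show ?case using Suc.IH E by (simp add: algebra_simps)
  qed simp
  have rem: "\<bar>?I - 2 * c * (\<Sum>k<N. (-1)^k / ((real (Suc k))\<^sup>2 + c\<^sup>2))\<bar> \<le> 2 / real (Suc N)" for N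
  proof -
    let ?R = "\<lambda>w. (-1)^N * exp (- (real N * w)) * fermi w * sin (c * w)"
    have d: "norm (?R w) \<le> 2 * exp (- (real (Suc N) * w))" for w
    proof -
      have "norm (?R w) \<le> 1 * exp (- (real N * w)) * (2 * exp (-w)) * 1"
        unfolding norm_mult by (intro mult_mono) (use fermi_bounds[of w] in auto)
      also have "\<dots> = 2 * exp (- (real (Suc N) * w))" by (simp add: exp_add[symmetric] algebra_simps)
      finally show ?thesis .
    qed
    have ib: "integrable hl (\<lambda>w. 2 * exp (- (real (Suc N) * w)))"
      by (intro integrable_mult_right integrable_hl_exp) auto
    have iR: "integrable hl ?R" 
      by (rule hl_integrable_dominated[OF ib _ d]) measurable
    have "?I = integral\<^sup>L hl (\<lambda>w. 2 * (\<Sum>k<N. (-1)^k * (exp (- (real (Suc k) * w)) * sin (c * w))) + ?R w)"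
    proof (rule Bochner_Integration.integral_cong[OF refl])
      fix w
      show "fermi w * sin (c * w) = 2 * (\<Sum>k<N. (-1)^k * (exp (- (real (Suc k) * w)) * sin (c * w))) + ?R w"
        by (subst alg[of _ N]) (simp add: distrib_right sum_distrib_right mult.assoc del: of_nat_Suc)
    qed
    also have "\<dots> = 2 * (\<Sum>k<N. (-1)^k * integral\<^sup>L hl (\<lambda>w. exp (- (real (Suc k) * w)) * sin (c * w))) + integral\<^sup>L hl ?R"
      using ie iR by (subst Bochner_Integration.integral_add) (auto simp: Bochner_Integration.integral_sum simp del: of_nat_Suc)
    also have "\<dots> = 2 * (\<Sum>k<N. (-1)^k * (c / ((real (Suc k))\<^sup>2 + c\<^sup>2))) + integral\<^sup>L hl ?R"
      by (simp add: integral_hl_exp_sin del: of_nat_Suc)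
    also have "\<dots> = 2 * c * (\<Sum>k<N. (-1)^k / ((real (Suc k))\<^sup>2 + c\<^sup>2)) + integral\<^sup>L hl ?R"
      by (simp add: sum_distrib_left mult_ac)
    finally have "?I - 2 * c * (\<Sum>k<N. (-1)^k / ((real (Suc k))\<^sup>2 + c\<^sup>2)) = integral\<^sup>L hl ?R" by simp
    moreover have "norm (integral\<^sup>L hl ?R) \<le> integral\<^sup>L hl (\<lambda>w. 2 * exp (- (real (Suc N) * w)))"
      by (rule Bochner_Integration.integral_norm_bound_integral[OF iR ib d])
    moreover have "integral\<^sup>L hl (\<lambda>w. 2 * exp (- (real (Suc N) * w))) = 2 / real (Suc N)"
      by (simp add: integral_hl_exp del: of_nat_Suc)
    ultimately show ?thesis by simp
  qed
  have "(\<lambda>N. 2 / real (Suc N)) \<longlonglongrightarrow> 0"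
    using tendsto_mult[OF tendsto_const[of 2] LIMSEQ_inverse_real_of_nat] by (simp add: inverse_eq_divide)
  then have "(\<lambda>N. ?I - 2 * c * (\<Sum>k<N. (-1)^k / ((real (Suc k))\<^sup>2 + c\<^sup>2))) \<longlonglongrightarrow> 0"
    by (rule Lim_null_comparison[rotated]) (use rem in \<open>auto simp del: of_nat_Suc\<close>)
  moreover have "(\<lambda>N. ?I - 2 * c * (\<Sum>k<N. (-1)^k / ((real (Suc k))\<^sup>2 + c\<^sup>2))) 
     \<longlonglongrightarrow> ?I - 2 * c * (1 / (2 * c\<^sup>2) - pi / (2 * c * sinh (pi * c)))"
    using sums_alternating_csch[OF assms] unfolding sums_def by (intro tendsto_intros)
  ultimately have "?I - 2 * c * (1 / (2 * c\<^sup>2) - pi / (2 * c * sinh (pi * c))) = 0"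
    using LIMSEQ_unique by blast
  moreover have "2 * c * (1 / (2 * c\<^sup>2) - pi / (2 * c * sinh (pi * c))) = 1 / c - pi / sinh (pi * c)"
    using assms by (simp add: right_diff_distrib power2_eq_square)
  ultimately show ?thesis by simp
qed

lemma integral_even_hl:
  fixes f :: "real \<Rightarrow> real"
  assumes f: "integrable lborel f" and even: "\<And>x. f (- x) = f x"
  shows "integral\<^sup>L lborel f = 2 * integral\<^sup>L hl f"
proof -
  have [measurable]: "f \<in> borel_measurable borel" using f by auto
  have i: "integrable lborel (\<lambda>x. indicator {0<..} x * f x)" "integrable lborel (\<lambda>x. indicator {..<0} x * f x)"
    using integrable_mult_indicator[OF _ f, of "{0<..}"] integrable_mult_indicator[OF _ f, of "{..<0}"] by simp_all
  have "integral\<^sup>L lborel f = integral\<^sup>L lborel (\<lambda>x. indicator {0<..} x * f x + indicator {..<0} x * f x)"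
    by (intro integral_cong_AE AE_I[where N = "{0}"]) (auto simp: indicator_def)
  also have "\<dots> = integral\<^sup>L lborel (\<lambda>x. indicator {0<..} x * f x) + integral\<^sup>L lborel (\<lambda>x. indicator {..<0} x * f x)"
    using i by simp
  also have "integral\<^sup>L lborel (\<lambda>x. indicator {..<0} x * f x) = integral\<^sup>L lborel (\<lambda>x. indicator {0<..} x * f x)"
    by (subst lborel_integral_real_affine[where c = "-1" and t = 0])
       (auto simp: even indicator_def intro!: Bochner_Integration.integral_cong)
  finally show ?thesis by (simp add: integral_hl set_lebesgue_integral_def)
qed

lemma integrable_odd_hl:
  fixes f :: "real \<Rightarrow> real"
  assumes f: "integrable hl f" and [measurable]: "f \<in> borel_measurable borel" and odd: "\<And>x. f (- x) = - f x"
  shows "integrable lborel f"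
proof -
  have i1: "integrable lborel (\<lambda>x. indicator {0<..} x * f x)"
    using f by (simp add: integrable_hl_iff set_integrable_def)
  have "integrable lborel (\<lambda>x. indicator {0<..} (0 + (-1) * x) * f (0 + (-1) * x))"
    using lborel_integrable_real_affine[OF i1, of "-1" 0] by simp
  then have "integrable lborel (\<lambda>x. - (indicator {0<..} (-x) * f (- x)))" by simp
  from Bochner_Integration.integrable_add[OF i1 this]
  show ?thesis 
    by (subst integrable_cong_AE[where g = "\<lambda>x. indicator {0<..} x * f x + - (indicator {0<..} (-x) * f (- x))"])
       (auto simp: odd indicator_def intro!: AE_I[where N = "{0}"])
qed

text \<open>
  From \<open>2 sinh u / (cosh u + cosh v) = tanh ((v + u) / 2) - tanh ((v - u) / 2)\<close>. Here \<open>tanh (w / 2)\<close>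
  is written as \<open>sgn w\<close> minus an odd integrable function, and the two signs combine to the
  indicator.
\<close>

lemma sinh_over_cosh_sum:
  fixes u v :: real
  assumes "u > 0" "v > 0" "v \<noteq> u"
  shows "sinh u / (cosh u + cosh v) = 
    (sgn (v - u) * fermi \<bar>v - u\<bar> - sgn (v + u) * fermi \<bar>v + u\<bar>) / 2 + indicator {-u..u} v"
proof -
  define X Y where "X = exp u" and "Y = exp v"
  have p: "X > 0" "Y > 0" by (auto simp: X_def Y_def)
  have l: "sinh u / (cosh u + cosh v) = (X - 1 / X) / (X + 1 / X + Y + 1 / Y)"
  proof -
    have "sinh u = (X - 1 / X) / 2" "cosh u + cosh v = (X + 1 / X + Y + 1 / Y) / 2"
      by (simp_all add: sinh_def cosh_def X_def Y_def exp_minus inverse_eq_divide add_divide_distrib)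
    moreover have "(a / 2) / (b / 2) = a / b" for a b :: real by simp
    ultimately show ?thesis by metis
  qed
  have p2: "X * Y + 1 > 0" "X + Y > 0" "X\<^sup>2*Y + Y + X*Y\<^sup>2 + X > 0" using p by (simp_all add: add_pos_pos)
  have lx: "(X - 1 / X) / (X + 1 / X + Y + 1 / Y) = Y * (X\<^sup>2 - 1) / ((X * Y + 1) * (X + Y))"
  proof -
    have a: "X - 1 / X = (X\<^sup>2 - 1) / X" using p by (simp add: field_simps power2_eq_square)
    have b: "X + 1 / X + Y + 1 / Y = ((X * Y + 1) * (X + Y)) / (X * Y)" using p by (simp add: field_simps power2_eq_square)
    have "(A / X) / (N / (X * Y)) = Y * A / N" for A N using p by simp
    then show ?thesis unfolding a b .
  qed
  have f1: "fermi (v + u) = 2 / (X * Y + 1)" 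
    by (simp add: fermi_def exp_add X_def Y_def mult.commute)
  have f2: "fermi (v - u) = 2 * X / (X + Y)" using p
    by (simp add: fermi_def exp_diff X_def Y_def field_simps)
  have f3: "fermi (u - v) = 2 * Y / (X + Y)" using p
    by (simp add: fermi_def exp_diff X_def Y_def field_simps)
  show ?thesis
  proof (cases "v < u")
    case True
    have "Y * (X\<^sup>2 - 1) / ((X * Y + 1) * (X + Y)) = (- (2 * Y / (X + Y)) - 2 / (X * Y + 1)) / 2 + 1"
      using p2 by (simp add: field_simps power2_eq_square)
    then show ?thesis using True assms by (simp add: l lx f1 f3)
  next
    case False
    have "Y * (X\<^sup>2 - 1) / ((X * Y + 1) * (X + Y)) = ((2 * X / (X + Y)) - 2 / (X * Y + 1)) / 2"
      using p2 by (simp add: field_simps power2_eq_square)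
    then show ?thesis using False assms by (simp add: l lx f1 f2)
  qed
qed

text \<open>
  After the decomposition above, the integral over the whole line splits into two translates of an
  odd function \<open>E\<close> and an integral over \<open>[-u, u]\<close>. Translating back produces the factor
  \<open>sin (c u)\<close> and the sine transform of \<open>E\<close>.
\<close>

theorem integral_cos_over_cosh_sum:
  assumes c: "c > 0" and u: "u > 0"
  shows "integral\<^sup>L hl (\<lambda>v. cos (c * v) / (cosh u + cosh v)) = pi * sin (c * u) / (sinh (pi * c) * sinh u)"
proof -
  define E where "E w = sgn w * fermi \<bar>w\<bar>" for w
  have [measurable]: "E \<in> borel_measurable borel" unfolding E_def by measurable
  have E_odd: "E (- w) = - E w" for w by (simp add: E_def)
  have iE0: "integrable hl E"
    by (rule hl_integrable_dominated[OF integrable_hl_fermi])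
       (auto simp: E_def abs_mult less_imp_le[OF fermi_bounds(1)])
  have iE: "integrable lborel E"
    by (rule integrable_odd_hl) (auto simp: E_odd iE0)
  have bd: "integrable lborel (\<lambda>w. g w * E w)" if [measurable]: "g \<in> borel_measurable borel" and "\<And>w. \<bar>g w\<bar> \<le> 1" for g
    by (rule Bochner_Integration.integrable_bound[OF iE])
       (use that in \<open>auto simp: abs_mult intro!: AE_I2 mult_left_le_one_le\<close>)
  have sh1: "integrable lborel (\<lambda>v. cos (c * v) * E (v - u))"
            "integral\<^sup>L lborel (\<lambda>v. cos (c * v) * E (v - u)) = integral\<^sup>L lborel (\<lambda>w. cos (c * (w + u)) * E w)"
  proof -
    show "integrable lborel (\<lambda>v. cos (c * v) * E (v - u))"
      using lborel_integrable_real_affine[OF bd[of "\<lambda>w. cos (c * (w + u))"], of 1 "-u"] by simp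
    show "integral\<^sup>L lborel (\<lambda>v. cos (c * v) * E (v - u)) = integral\<^sup>L lborel (\<lambda>w. cos (c * (w + u)) * E w)"
      by (subst lborel_integral_real_affine[where c = 1 and t = u]) (auto simp: add.commute)
  qed
  have sh2: "integrable lborel (\<lambda>v. cos (c * v) * E (v + u))"
            "integral\<^sup>L lborel (\<lambda>v. cos (c * v) * E (v + u)) = integral\<^sup>L lborel (\<lambda>w. cos (c * (w - u)) * E w)"
  proof -
    show "integrable lborel (\<lambda>v. cos (c * v) * E (v + u))"
      using lborel_integrable_real_affine[OF bd[of "\<lambda>w. cos (c * (w - u))"], of 1 "u"] by (simp add: add.commute)
    show "integral\<^sup>L lborel (\<lambda>v. cos (c * v) * E (v + u)) = integral\<^sup>L lborel (\<lambda>w. cos (c * (w - u)) * E w)"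
      by (subst lborel_integral_real_affine[where c = 1 and t = "-u"]) auto
  qed
  have ic: "integrable lborel (\<lambda>v. cos (c * v) * indicator {-u..u} v)"
    "integral\<^sup>L lborel (\<lambda>v. cos (c * v) * indicator {-u..u} v) = 2 * sin (c * u) / c"
  proof -
    show "integrable lborel (\<lambda>v. cos (c * v) * indicator {-u..u} v)"
      using borel_integrable_atLeastAtMost[of "-u" u "\<lambda>v. cos (c * v)"] by (simp add: indicator_def if_distrib cong: if_cong)
    have "integral\<^sup>L lborel (\<lambda>v. cos (c * v) * indicator {-u..u} v) = sin (c * u) / c - sin (c * (- u)) / c"
      using c u by (intro integral_FTC_Icc_real) (auto intro!: derivative_eq_intros)
    then show "integral\<^sup>L lborel (\<lambda>v. cos (c * v) * indicator {-u..u} v) = 2 * sin (c * u) / c" by simp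
  qed
  define \<Psi> where "\<Psi> v = (cos (c * v) * E (v - u) - cos (c * v) * E (v + u)) / 2 + cos (c * v) * indicator {-u..u} v" for v
  have i\<Psi>: "integrable lborel \<Psi>"
    unfolding \<Psi>_def using sh1(1) sh2(1) ic(1) by simp
  have even: "\<Psi> (- v) = \<Psi> v" for v
  proof -
    have "E (- v - u) = - E (v + u)" "E (- v + u) = - E (v - u)"
      using E_odd[of "v + u"] E_odd[of "v - u"] by (simp_all add: algebra_simps minus_diff_commute)
    then show ?thesis unfolding \<Psi>_def by (auto simp: indicator_def algebra_simps)
  qed
  have "sinh u * integral\<^sup>L hl (\<lambda>v. cos (c * v) / (cosh u + cosh v)) = integral\<^sup>L hl (\<lambda>v. cos (c * v) * (sinh u / (cosh u + cosh v)))"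
    by (subst integral_mult_right_zero[symmetric]) (simp add: mult_ac)
  also have "\<dots> = integral\<^sup>L hl \<Psi>"
  proof (rule integral_cong_AE)
    have "AE v in lborel. v \<noteq> u" by (rule AE_lborel_singleton)
    then show "AE v in hl. cos (c * v) * (sinh u / (cosh u + cosh v)) = \<Psi> v"
      unfolding AE_hl
    proof eventually_elim
      case (elim v)
      show ?case
      proof
        assume "0 < v"
        show "cos (c * v) * (sinh u / (cosh u + cosh v)) = \<Psi> v"
          unfolding sinh_over_cosh_sum[OF u \<open>0 < v\<close> elim] \<Psi>_def E_def by (simp add: algebra_simps)
      qed
    qed
  qed (unfold \<Psi>_def, measurable)
  also have "\<dots> = integral\<^sup>L lborel \<Psi> / 2"
    using integral_even_hl[OF i\<Psi> even] by simp
  also have "integral\<^sup>L lborel \<Psi> = (integral\<^sup>L lborel (\<lambda>w. cos (c * (w + u)) * E w) - integral\<^sup>L lborel (\<lambda>w. cos (c * (w - u)) * E w)) / 2 + 2 * sin (c * u) / c"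
    unfolding \<Psi>_def using sh1 sh2 ic by simp
  also have "integral\<^sup>L lborel (\<lambda>w. cos (c * (w + u)) * E w) - integral\<^sup>L lborel (\<lambda>w. cos (c * (w - u)) * E w)
     = integral\<^sup>L lborel (\<lambda>w. - 2 * sin (c * u) * (sin (c * w) * E w))"
    by (subst Bochner_Integration.integral_diff[symmetric]; (intro bd; simp)?)
       (simp add: cos_add cos_diff distrib_left right_diff_distrib left_diff_distrib algebra_simps)
  also have "\<dots> = - 2 * sin (c * u) * integral\<^sup>L lborel (\<lambda>w. sin (c * w) * E w)"
    by (rule integral_mult_right_zero)
  also have "integral\<^sup>L lborel (\<lambda>w. sin (c * w) * E w) = 2 * integral\<^sup>L hl (\<lambda>w. sin (c * w) * E w)"
    by (intro integral_even_hl bd) (auto simp: E_odd)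
  also have "integral\<^sup>L hl (\<lambda>w. sin (c * w) * E w) = integral\<^sup>L hl (\<lambda>w. fermi w * sin (c * w))"
    by (rule integral_hl_cong) (auto simp: E_def)
  also have "\<dots> = 1 / c - pi / sinh (pi * c)" by (rule integral_hl_fermi_sin[OF c])
  finally have fin: "sinh u * integral\<^sup>L hl (\<lambda>v. cos (c * v) / (cosh u + cosh v)) =
    ((- 2 * sin (c * u) * (2 * (1 / c - pi / sinh (pi * c)))) / 2 + 2 * sin (c * u) / c) / 2" .
  then have "sinh u * integral\<^sup>L hl (\<lambda>v. cos (c * v) / (cosh u + cosh v)) = pi * sin (c * u) / sinh (pi * c)"
  proof -
    have "((- 2 * s * (2 * (1 / c - S))) / 2 + 2 * s / c) / 2 = s * S" for s S
      using c by (simp add: field_simps)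
    from this[of "sin (c * u)" "pi / sinh (pi * c)"] show ?thesis
      using fin by simp
  qed
  moreover have "sinh u \<noteq> 0" using u by simp
  ultimately have "integral\<^sup>L hl (\<lambda>v. cos (c * v) / (cosh u + cosh v)) = pi * sin (c * u) / sinh (pi * c) / sinh u"
    by (metis nonzero_mult_div_cancel_left)
  then show ?thesis by simp
qed

section \<open>The Macdonald function of imaginary order and its Laplace integrals\<close>

lemma AE_hl_pair: "AE z in hl \<Otimes>\<^sub>M hl. 0 < fst z \<and> 0 < snd z"
  by (rule hl_hl.AE_pair_measure) (measurable, auto intro!: AE_hlI)

lemma le_sinh: "u \<le> sinh u" if "0 \<le> u" for u :: real
  using real_le_x_sinh[OF that] by (simp add: sinh_def exp_minus)

lemma exp_neg_cosh_le:
  fixes y v :: real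
  assumes "y > 0"
  shows "exp (- (y * cosh v)) \<le> exp (- (y * v))"
proof -
  have "v \<le> cosh v"
  proof (cases "v \<ge> 0")
    case True
    have "cosh v - sinh v > 0" by (simp add: cosh_minus_sinh)
    then show ?thesis using le_sinh[OF True] by simp
  qed (use cosh_real_pos[of v] in linarith)
  then show ?thesis using assms by simp
qed

lemma inverse_cosh_le: "1 / cosh v \<le> 2 * exp (- v)" for v :: real
proof -
  have "exp v \<le> 2 * cosh v" by (simp add: cosh_def)
  moreover have "cosh v > 0" by simp
  ultimately show ?thesis by (simp add: exp_minus field_simps)
qed

lemma integrable_hl_pair_exp_cosh: "integrable (hl \<Otimes>\<^sub>M hl) (\<lambda>(y, v). exp (- (y * cosh v)))"
proof -
  have "integrable (hl \<Otimes>\<^sub>M hl) (\<lambda>(v, y). exp (- (cosh v * y)))"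
  proof (rule hl_hl.Fubini_integrable)
    have "(\<lambda>v. \<integral>y. norm (case (v, y) of (v, y) \<Rightarrow> exp (- (cosh v * y))) \<partial>hl) = (\<lambda>v. 1 / cosh v)"
      by (simp add: integral_hl_exp)
    moreover have "integrable hl (\<lambda>v. 1 / cosh v)"
      by (rule hl_integrable_dominated[where g = "\<lambda>v. 2 * exp (- (1 * v))"])
         (use inverse_cosh_le in \<open>auto simp: integrable_hl_exp[of 1, simplified]\<close>)
    ultimately show "integrable hl (\<lambda>v. \<integral>y. norm (case (v, y) of (v, y) \<Rightarrow> exp (- (cosh v * y))) \<partial>hl)" by simp
    show "AE v in hl. integrable hl (\<lambda>y. case (v, y) of (v, y) \<Rightarrow> exp (- (cosh v * y)))"
      by (simp add: integrable_hl_exp)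
  qed measurable
  from hl_hl.integrable_product_swap[OF this] show ?thesis 
    by (simp add: case_prod_beta' mult.commute)
qed

text \<open>
  \<open>macdonald c y\<close> is \<open>K\<^bsub>ic\<^esub>(y)\<close> as a real number, for real \<open>c\<close> and \<open>y > 0\<close>; for \<open>y \<le> 0\<close> the integrand
  is not integrable and the value 0 plays no role.
\<close>

definition macdonald :: "real \<Rightarrow> real \<Rightarrow> real" where
  "macdonald c y = integral\<^sup>L hl (\<lambda>v. exp (- (y * cosh v)) * cos (c * v))"

lemma macdonald_measurable [measurable]: "macdonald c \<in> borel_measurable borel"
  unfolding macdonald_def by measurable

lemma integrable_macdonald_integrand:
  assumes "y > 0"
  shows "integrable hl (\<lambda>v. exp (- (y * cosh v)) * cos (c * v))"
proof (rule hl_integrable_dominated[OF integrable_hl_exp[OF assms]])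
  fix v
  have "norm (exp (- (y * cosh v)) * cos (c * v)) \<le> exp (- (y * v)) * 1"
    unfolding norm_mult using exp_neg_cosh_le[OF assms, of v] by (intro mult_mono) auto
  then show "norm (exp (- (y * cosh v)) * cos (c * v)) \<le> exp (- (y * v))" by simp
qed measurable

lemma abs_macdonald_le:
  assumes "y > 0"
  shows "\<bar>macdonald c y\<bar> \<le> macdonald 0 y"
proof -
  have "norm (macdonald c y) \<le> macdonald 0 y"
    unfolding macdonald_def
    by (rule Bochner_Integration.integral_norm_bound_integral)
       (use integrable_macdonald_integrand[OF assms, of c] integrable_macdonald_integrand[OF assms, of 0] in 
         \<open>auto simp: abs_mult\<close>)
  then show ?thesis by simp
qed

lemma integrable_macdonald: "integrable hl (macdonald c)"
proof -
  have "integrable hl (\<lambda>y. \<integral>v. exp (- (y * cosh v)) \<partial>hl)"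
    using hl_hl.integrable_fst'[OF integrable_hl_pair_exp_cosh] by simp
  then have "integrable hl (macdonald 0)"
    unfolding macdonald_def[abs_def] by simp
  then show ?thesis
    by (rule hl_integrable_dominated) (auto simp: abs_macdonald_le)
qed

lemma laplace_macdonald_cosh:
  shows "integral\<^sup>L hl (\<lambda>y. exp (- (y * cosh u)) * macdonald c y) = integral\<^sup>L hl (\<lambda>v. cos (c * v) / (cosh u + cosh v))"
proof -
  let ?f = "\<lambda>y v. exp (- (y * cosh u)) * (exp (- (y * cosh v)) * cos (c * v))"
  have "integrable (hl \<Otimes>\<^sub>M hl) (\<lambda>(y, v). ?f y v)"
  proof (rule Bochner_Integration.integrable_bound[OF integrable_hl_pair_exp_cosh])
    show "AE z in hl \<Otimes>\<^sub>M hl. norm (case z of (y, v) \<Rightarrow> ?f y v) \<le> norm (case z of (y, v) \<Rightarrow> exp (- (y * cosh v)))"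
      using AE_hl_pair
    proof eventually_elim
      case (elim z)
      obtain y v where z: "z = (y, v)" by force
      have "norm (?f y v) \<le> 1 * (exp (- (y * cosh v)) * 1)"
        unfolding norm_mult using elim z by (intro mult_mono) auto
      then show ?case by (simp add: z)
    qed
  qed measurable
  from hl_hl.Fubini_integral[OF this]
  have "integral\<^sup>L hl (\<lambda>y. exp (- (y * cosh u)) * macdonald c y) = (\<integral>v. \<integral>y. ?f y v \<partial>hl \<partial>hl)"
    by (simp add: macdonald_def)
  also have "\<dots> = (\<integral>v. cos (c * v) * (\<integral>y. exp (- ((cosh u + cosh v) * y)) \<partial>hl) \<partial>hl)"
  proof (rule Bochner_Integration.integral_cong[OF refl])
    fix v
    have "(\<integral>y. ?f y v \<partial>hl) = (\<integral>y. cos (c * v) * exp (- ((cosh u + cosh v) * y)) \<partial>hl)"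
      by (simp add: exp_add exp_diff exp_minus algebra_simps divide_inverse)
    then show "(\<integral>y. ?f y v \<partial>hl) = cos (c * v) * (\<integral>y. exp (- ((cosh u + cosh v) * y)) \<partial>hl)"
      by simp
  qed
  also have "\<dots> = (\<integral>v. cos (c * v) / (cosh u + cosh v) \<partial>hl)"
    by (simp add: integral_hl_exp add_pos_pos)
  finally show ?thesis .
qed

lemma laplace_macdonald:
  assumes "c > 0" "u > 0"
  shows "integral\<^sup>L hl (\<lambda>y. exp (- (y * cosh u)) * macdonald c y) = pi * sin (c * u) / (sinh (pi * c) * sinh u)"
  by (simp add: laplace_macdonald_cosh integral_cos_over_cosh_sum[OF assms])

text \<open>
  The function \<open>y \<mapsto> \<integral> exp (- y cosh u) h(u) sinh u du\<close>, integrated over \<open>[0, \<pi>]\<close>. For \<open>y > 0\<close>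
  both \<open>f(y)\<close> in the first expansion and \<open>(n / y) J(y, in, \<pi>)\<close> are of this form.
\<close>

definition cosh_laplace :: "(real \<Rightarrow> complex) \<Rightarrow> real \<Rightarrow> complex" where
  "cosh_laplace h y = (LINT u:{0..pi}|lborel. complex_of_real (exp (- (y * cosh u)) * sinh u) * h u)"

lemma set_integrable_continuous:
  fixes h :: "real \<Rightarrow> 'a::{banach, second_countable_topology}"
  assumes "continuous_on {a..b} h"
  shows "set_integrable lborel {a..b} h"
  using borel_integrable_compact[OF compact_Icc assms] 
  by (simp add: set_integrable_def)

text \<open>
  The pairing of \<open>K\<^bsub>ic\<^esub>\<close> with such a function is a multiple of a sine transform of \<open>h\<close>: the factor
  \<open>sinh u\<close> cancels against the Laplace integral of \<open>K\<^bsub>ic\<^esub>\<close>. Fubini's theorem applies because \<open>K\<^bsub>ic\<^esub>\<close> is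
  dominated by the integrable function \<open>K\<^sub>0\<close>.
\<close>

lemma
  fixes h :: "real \<Rightarrow> complex"
  assumes h: "continuous_on UNIV h" and c: "c > 0"
  shows integrable_macdonald_cosh_laplace: "integrable hl (\<lambda>y. complex_of_real (macdonald c y) * cosh_laplace h y)"
    and integral_macdonald_cosh_laplace: 
     "integral\<^sup>L hl (\<lambda>y. complex_of_real (macdonald c y) * cosh_laplace h y) = 
       complex_of_real (pi / sinh (pi * c)) * (LINT u:{0..pi}|lborel. h u * complex_of_real (sin (c * u)))"
proof -
  have [measurable]: "h \<in> borel_measurable borel"
    using h by (rule borel_measurable_continuous_onI)
  have "compact ((\<lambda>u. norm (complex_of_real (sinh u) * h u)) ` {0..pi})"
    by (intro compact_continuous_image continuous_intros continuous_on_subset[OF h]) auto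
  then have "bounded ((\<lambda>u. norm (complex_of_real (sinh u) * h u)) ` {0..pi})" by (rule compact_imp_bounded)
  then obtain B where B: "\<And>u. u \<in> {0..pi} \<Longrightarrow> norm (complex_of_real (sinh u) * h u) \<le> B"
    by (force simp: bounded_iff)
  define f where "f y u = complex_of_real (macdonald c y) * (indicator {0..pi} u *\<^sub>R (complex_of_real (exp (- (y * cosh u)) * sinh u) * h u))" for y u
  have fb: "norm (f y u) \<le> macdonald 0 y * (indicator {0..pi} u * B)" if "0 < y" for y u
  proof (cases "u \<in> {0..pi}")
    case True
    have "norm (f y u) = \<bar>macdonald c y\<bar> * (exp (- (y * cosh u)) * norm (complex_of_real (sinh u) * h u))"
      using True by (simp add: f_def norm_mult abs_mult)
    also have "\<dots> \<le> macdonald 0 y * (1 * B)"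
      using B[OF True] abs_macdonald_le[OF that, of c] that by (intro mult_mono) auto
    finally show ?thesis using True by simp
  qed (simp add: f_def)
  have [measurable]: "case_prod f \<in> borel_measurable (hl \<Otimes>\<^sub>M lborel)"
    unfolding f_def by measurable
  have iB: "integrable lborel (\<lambda>u. indicat_real {0..pi} u * B)"
    by (intro integrable_mult_left integrable_real_indicator) auto
  have fi: "integrable lborel (f y)" if "0 < y" for y
    by (rule Bochner_Integration.integrable_bound[OF integrable_mult_right[OF iB, of "macdonald 0 y"]])
       (use fb[OF that] in \<open>auto intro!: AE_I2 order_trans[OF fb[OF that]]\<close>)
  have int: "integrable (hl \<Otimes>\<^sub>M lborel) (case_prod f)"
  proof (rule hl_lborel.Fubini_integrable)
    show "AE y in hl. integrable lborel (\<lambda>u. case (y, u) of (y, u) \<Rightarrow> f y u)"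
      using fi by (auto intro!: AE_hlI)
    show "integrable hl (\<lambda>y. \<integral>u. norm (case (y, u) of (y, u) \<Rightarrow> f y u) \<partial>lborel)"
    proof (rule hl_integrable_dominated)
      show "integrable hl (\<lambda>y. macdonald 0 y * (\<integral>u. indicat_real {0..pi} u * B \<partial>lborel))"
        by (intro integrable_mult_left integrable_macdonald)
      fix y :: real assume y: "0 < y"
      have "norm (\<integral>u. norm (f y u) \<partial>lborel) \<le> (\<integral>u. macdonald 0 y * (indicat_real {0..pi} u * B) \<partial>lborel)"
        by (rule Bochner_Integration.integral_norm_bound_integral)
          (use fb[OF y] fi[OF y] iB in auto)
      then show "norm (\<integral>u. norm (case (y, u) of (y, u) \<Rightarrow> f y u) \<partial>lborel) \<le> macdonald 0 y * (\<integral>u. indicat_real {0..pi} u * B \<partial>lborel)"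
        by simp
    qed measurable
  qed measurable
  have fst: "(\<integral>u. f y u \<partial>lborel) = complex_of_real (macdonald c y) * cosh_laplace h y" for y
    unfolding f_def cosh_laplace_def set_lebesgue_integral_def by (rule integral_mult_right_zero)
  show "integrable hl (\<lambda>y. complex_of_real (macdonald c y) * cosh_laplace h y)"
    using hl_lborel.integrable_fst'[OF int] by (simp add: fst)
  have "integral\<^sup>L hl (\<lambda>y. complex_of_real (macdonald c y) * cosh_laplace h y) = (\<integral>u. \<integral>y. f y u \<partial>hl \<partial>lborel)"
    using hl_lborel.Fubini_integral[OF int] by (simp add: fst)
  also have "\<dots> = (\<integral>u. complex_of_real (pi / sinh (pi * c)) * (indicator {0..pi} u *\<^sub>R (h u * complex_of_real (sin (c * u)))) \<partial>lborel)"
  proof (rule integral_cong_AE)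
    show "AE u in lborel. (\<integral>y. f y u \<partial>hl) = complex_of_real (pi / sinh (pi * c)) * (indicator {0..pi} u *\<^sub>R (h u * complex_of_real (sin (c * u))))"
      using AE_lborel_singleton[of 0]
    proof eventually_elim
      case (elim u)
      show ?case
      proof (cases "u \<in> {0..pi}")
        case True
        then have u: "u > 0" using elim by simp
        then have "sinh u > 0" by simp
        have "(\<integral>y. f y u \<partial>hl) = (\<integral>y. (complex_of_real (sinh u) * h u) * complex_of_real (exp (- (y * cosh u)) * macdonald c y) \<partial>hl)"
          using True by (simp add: f_def mult_ac)
        also have "\<dots> = (complex_of_real (sinh u) * h u) * complex_of_real (\<integral>y. exp (- (y * cosh u)) * macdonald c y \<partial>hl)"
          unfolding integral_mult_right_zero integral_complex_of_real ..
        also have "\<dots> = complex_of_real (pi / sinh (pi * c)) * (h u * complex_of_real (sin (c * u)))"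
          using \<open>sinh u > 0\<close> by (simp add: laplace_macdonald[OF c u])
        finally show ?thesis using True by simp
      qed (simp add: f_def)
    qed
  qed measurable
  also have "\<dots> = complex_of_real (pi / sinh (pi * c)) * (LINT u:{0..pi}|lborel. h u * complex_of_real (sin (c * u)))"
    unfolding set_lebesgue_integral_def by (rule integral_mult_right_zero)
  finally show "integral\<^sup>L hl (\<lambda>y. complex_of_real (macdonald c y) * cosh_laplace h y) = 
       complex_of_real (pi / sinh (pi * c)) * (LINT u:{0..pi}|lborel. h u * complex_of_real (sin (c * u)))" .
qed

section \<open>Square integrability of the Macdonald function\<close>

text \<open>
  A bound that is uniform in \<open>c\<close>: expanding \<open>1 / sinh u\<close> into \<open>2 exp (- (2 k + 1) u)\<close> turns the
  integral into the sum of \<open>2 c / ((2 k + 1)\<^sup>2 + c\<^sup>2)\<close>, which is dominated by a telescoping sum.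
\<close>

lemma integral_hl_sin_over_sinh:
  assumes "c > 0"
  shows "\<bar>integral\<^sup>L hl (\<lambda>u. sin (c * u) / sinh u)\<bar> \<le> 2"
proof -
  let ?g = "\<lambda>u. sin (c * u) / sinh u"
  have gb: "\<bar>?g u\<bar> \<le> c" if "u > 0" for u
  proof -
    have "\<bar>sin (c * u)\<bar> \<le> \<bar>c * u\<bar>" by (rule abs_sin_x_le_abs_x)
    also have "\<dots> \<le> c * sinh u" using that assms le_sinh[of u] by (simp add: abs_mult)
    finally show ?thesis using that by (simp add: field_simps)
  qed
  have ie: "integrable hl (\<lambda>u. exp (- (x * u)) * sin (c * u))" if "x > 0" for x
    by (rule hl_integrable_dominated[OF integrable_hl_exp[OF that]]) (auto simp: abs_mult)
  have alg: "?g u = (\<Sum>k<N. 2 * (exp (- (real (2 * k + 1) * u)) * sin (c * u))) + exp (- (real (2 * N) * u)) * ?g u" if "u > 0" for u N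
  proof (induction N)
    case (Suc N)
    have s: "sinh u > 0" using that by simp
    have E: "exp (- (real (2 * N + 1) * u)) = exp (- (real (2 * N) * u)) * exp (-u)"
      "exp (- (real (2 * Suc N) * u)) = exp (- (real (2 * N) * u)) * exp (- (2 * u))"
      by (simp_all add: exp_add[symmetric] algebra_simps)
    have "1 - exp (- (2 * u)) = 2 * exp (-u) * sinh u"
      by (simp add: sinh_def right_diff_distrib exp_add[symmetric])
    moreover have "?g u - exp (- (2 * u)) * ?g u = (1 - exp (- (2 * u))) * ?g u"
      by (simp only: left_diff_distrib mult_1_left)
    ultimately have "?g u - exp (- (2 * u)) * ?g u = 2 * (exp (-u) * sin (c * u))"
      using s by simp
    then have step: "A * (?g u - exp (- (2 * u)) * ?g u) = A * (2 * (exp (-u) * sin (c * u)))" for A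
      by simp
    have "A * ?g u = 2 * ((A * exp (-u)) * sin (c * u)) + (A * exp (- (2 * u))) * ?g u" for A
      using step[of A] by (simp add: algebra_simps)
    from this[of "exp (- (real (2 * N) * u))"] Suc.IH show ?case
      unfolding E sum.lessThan_Suc by linarith
  qed simp
  have bd: "\<bar>integral\<^sup>L hl ?g\<bar> \<le> 2 + c * inverse (real (Suc N))" for N
  proof -
    let ?R = "\<lambda>u. exp (- (real (2 * Suc N) * u)) * ?g u"
    have Rb: "norm (?R u) \<le> c * exp (- (real (2 * Suc N) * u))" if "u > 0" for u
      using mult_right_mono[OF gb[OF that], of "exp (- (real (2 * Suc N) * u))"] 
      by (simp add: abs_mult mult.commute)
    have ic: "integrable hl (\<lambda>u. c * exp (- (real (2 * Suc N) * u)))"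
      by (intro integrable_mult_right integrable_hl_exp) auto
    have iR: "integrable hl ?R"
      by (rule hl_integrable_dominated[OF ic _ Rb]) measurable
    have "integral\<^sup>L hl ?g = integral\<^sup>L hl (\<lambda>u. (\<Sum>k<Suc N. 2 * (exp (- (real (2 * k + 1) * u)) * sin (c * u))) + ?R u)"
      by (rule integral_hl_cong[OF alg]) measurable
    also have "\<dots> = (\<Sum>k<Suc N. 2 * integral\<^sup>L hl (\<lambda>u. exp (- (real (2 * k + 1) * u)) * sin (c * u))) + integral\<^sup>L hl ?R"
      using ie iR
      by (subst Bochner_Integration.integral_add) (auto simp: Bochner_Integration.integral_sum simp del: sum.lessThan_Suc of_nat_add of_nat_mult of_nat_Suc intro!: Bochner_Integration.integrable_sum)
    also have "(\<Sum>k<Suc N. 2 * integral\<^sup>L hl (\<lambda>u. exp (- (real (2 * k + 1) * u)) * sin (c * u))) 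
       = (\<Sum>k<Suc N. 2 * (c / ((real (2 * k + 1))\<^sup>2 + c\<^sup>2)))"
      by (subst integral_hl_exp_sin) auto
    finally have eq: "integral\<^sup>L hl ?g = (\<Sum>k<Suc N. 2 * (c / ((real (2 * k + 1))\<^sup>2 + c\<^sup>2))) + integral\<^sup>L hl ?R" .
    have "norm (integral\<^sup>L hl ?R) \<le> integral\<^sup>L hl (\<lambda>u. c * exp (- (real (2 * Suc N) * u)))"
    proof (rule order_trans[OF integral_norm_bound integral_mono_AE])
      show "AE u in hl. norm (?R u) \<le> c * exp (- (real (2 * Suc N) * u))"
        using Rb by (intro AE_hlI)
    qed (rule integrable_norm[OF iR], rule ic)
    also have "\<dots> = c * (1 / real (2 * Suc N))"
      by (subst integral_mult_right_zero, subst integral_hl_exp) auto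
    also have "\<dots> \<le> c * inverse (real (Suc N))"
      using assms by (simp add: field_simps)
    finally have R: "norm (integral\<^sup>L hl ?R) \<le> c * inverse (real (Suc N))" .
    have "(\<Sum>k<M. 2 * (c / ((real (2 * k + 1))\<^sup>2 + c\<^sup>2))) \<le> 2 * c * (1 / c - 1 / (2 * real M + c))" for M
    proof (induction M)
      case (Suc M)
      let ?x = "2 * real M + 1"
      have "2 * (c / (?x\<^sup>2 + c\<^sup>2)) \<le> 2 * c * (1 / (2 * real M + c) - 1 / (2 * real M + 2 + c))"
      proof -
        have p: "2 * real M + c > 0" "2 * real M + 2 + c > 0" using assms by auto
        have "(2 * real M + c) * (2 * real M + 2 + c) \<le> (?x + c)\<^sup>2"
          by (simp add: power2_eq_square algebra_simps)
        also have "\<dots> \<le> 2 * (?x\<^sup>2 + c\<^sup>2)" 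
          using sum_squares_ge_zero[of "?x - c" 0] by (simp add: power2_eq_square algebra_simps)
        finally have le: "(2 * real M + c) * (2 * real M + 2 + c) \<le> 2 * (?x\<^sup>2 + c\<^sup>2)" .
        have "2 * (c / q) = 4 * c / (2 * q)" for q by simp
        then have "2 * (c / (?x\<^sup>2 + c\<^sup>2)) = 4 * c / (2 * (?x\<^sup>2 + c\<^sup>2))" .
        also have "\<dots> \<le> 4 * c / ((2 * real M + c) * (2 * real M + 2 + c))"
          using p le assms by (intro divide_left_mono mult_pos_pos) (auto simp: add_pos_nonneg)
        also have "\<dots> = 2 * c * (1 / (2 * real M + c) - 1 / (2 * real M + 2 + c))"
          using p by (simp add: field_simps)
        finally show ?thesis .
      qed
      then show ?case using Suc by (simp add: algebra_simps)
    qed simp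
    from this[of "Suc N"] have S: "(\<Sum>k<Suc N. 2 * (c / ((real (2 * k + 1))\<^sup>2 + c\<^sup>2))) \<le> 2"
    proof (rule order_trans)
      have "2 * c * (1 / c - 1 / (2 * real (Suc N) + c)) \<le> 2 * c * (1 / c)"
        using assms by (intro mult_left_mono) auto
      then show "2 * c * (1 / c - 1 / (2 * real (Suc N) + c)) \<le> 2" using assms by simp
    qed
    have "(\<Sum>k<Suc N. 2 * (c / ((real (2 * k + 1))\<^sup>2 + c\<^sup>2))) \<ge> 0"
      using assms by (intro sum_nonneg) auto
    then show ?thesis using S R unfolding eq by simp
  qed
  have "(\<lambda>N. 2 + c * inverse (real (Suc N))) \<longlonglongrightarrow> 2 + c * 0"
    by (intro tendsto_intros LIMSEQ_inverse_real_of_nat)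
  then show ?thesis using bd
    by (intro LIMSEQ_le_const[where x = "2::real"]) auto
qed

text \<open>
  Equivalent to square integrability of \<open>K\<^sub>0\<close>; it justifies Fubini's theorem in the next lemma.
  It follows from \<open>1 / (cosh u + cosh v) \<le> 1 / sqrt (cosh u cosh v)\<close>.
\<close>

lemma integrable_pair_macdonald: "integrable (hl \<Otimes>\<^sub>M hl) (\<lambda>(y, u). exp (- (y * cosh u)) * macdonald 0 y)"
proof -
  let ?q = "\<lambda>u::real. 1 / sqrt (cosh u)"
  have iq: "integrable hl ?q"
  proof (rule hl_integrable_dominated)
    show "integrable hl (\<lambda>u. 2 * exp (- (1 / 2 * u)))"
      by (intro integrable_mult_right integrable_hl_exp) auto
    fix u :: real
    have "?q u = sqrt (1 / cosh u)" by (simp add: real_sqrt_divide)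
    also have "\<dots> \<le> sqrt (2 * exp (- u))" using inverse_cosh_le[of u] by simp
    also have "\<dots> \<le> sqrt ((2 * exp (- (1 / 2 * u)))\<^sup>2)"
    proof -
      have "(exp (- (1 / 2 * u)))\<^sup>2 = exp (- u)" by (simp add: exp_double[symmetric])
      then show ?thesis by (simp add: power_mult_distrib del: real_sqrt_abs)
    qed
    also have "\<dots> = 2 * exp (- (1 / 2 * u))" by (subst real_sqrt_abs) simp
    finally show "norm (?q u) \<le> 2 * exp (- (1 / 2 * u))" by simp
  qed measurable
  have ine: "1 / (cosh u + cosh v) \<le> ?q u * ?q v" for u v :: real
  proof -
    have p: "cosh u > 0" "cosh v > 0" by auto
    have "sqrt (cosh u * cosh v) \<le> (cosh u + cosh v) / 2" using p by (intro arith_geo_mean_sqrt) auto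
    then have "sqrt (cosh u) * sqrt (cosh v) \<le> cosh u + cosh v" 
      unfolding real_sqrt_mult by (rule order_trans) (use p in simp)
    then show ?thesis using p by (simp add: divide_simps add_pos_pos)
  qed
  have K0: "macdonald 0 y \<ge> 0" for y unfolding macdonald_def by (intro Bochner_Integration.integral_nonneg) auto
  have "integrable (hl \<Otimes>\<^sub>M hl) (\<lambda>(u, y). exp (- (y * cosh u)) * macdonald 0 y)"
  proof (rule hl_hl.Fubini_integrable)
    show "AE u in hl. integrable hl (\<lambda>y. case (u, y) of (u, y) \<Rightarrow> exp (- (y * cosh u)) * macdonald 0 y)"
      by (intro AE_I2, rule hl_integrable_dominated[OF integrable_macdonald[of 0]])
         (auto simp: abs_mult K0 intro!: mult_left_le_one_le)
    have "integrable hl (\<lambda>u. \<integral>v. 1 / (cosh u + cosh v) \<partial>hl)"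
    proof (rule hl_integrable_dominated[where g = "\<lambda>u. ?q u * integral\<^sup>L hl ?q"])
      show "integrable hl (\<lambda>u. ?q u * integral\<^sup>L hl ?q)" using iq by (rule integrable_mult_left)
      fix u :: real
      have i2: "integrable hl (\<lambda>v. ?q u * ?q v)" using iq by (rule integrable_mult_right)
      have "integrable hl (\<lambda>v. 1 / (cosh u + cosh v))"
        by (rule hl_integrable_dominated[OF i2]) (use ine in \<open>auto simp: add_pos_pos less_imp_le\<close>)
      then have "norm (\<integral>v. 1 / (cosh u + cosh v) \<partial>hl) \<le> (\<integral>v. ?q u * ?q v \<partial>hl)"
        using i2 ine by (intro Bochner_Integration.integral_norm_bound_integral) (auto simp: add_pos_pos less_imp_le)
      then show "norm (\<integral>v. 1 / (cosh u + cosh v) \<partial>hl) \<le> ?q u * integral\<^sup>L hl ?q" 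
        unfolding integral_mult_right_zero .
    qed measurable
    then show "integrable hl (\<lambda>u. \<integral>y. norm (case (u, y) of (u, y) \<Rightarrow> exp (- (y * cosh u)) * macdonald 0 y) \<partial>hl)"
      using laplace_macdonald_cosh[of _ 0] by (simp add: abs_mult K0)
  qed measurable
  from hl_hl.integrable_product_swap[OF this] show ?thesis 
    by (simp add: case_prod_beta')
qed

text \<open>
  Writing one factor of \<open>K\<^bsub>ic\<^esub>(y)\<^sup>2\<close> as its defining integral and applying the Laplace integral to the
  other gives an integral of \<open>sin (2 c u) / sinh u\<close>. The uniform bound on the latter yields the decay
  rate \<open>exp (- \<pi> c)\<close>, with no polynomial factor in \<open>c\<close>.
\<close>

lemma
  assumes "c > 0"
  shows integrable_macdonald_square: "integrable hl (\<lambda>y. (macdonald c y)\<^sup>2)"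
    and integral_macdonald_square: "integral\<^sup>L hl (\<lambda>y. (macdonald c y)\<^sup>2) \<le> pi / sinh (pi * c)"
proof -
  define f where "f y u = macdonald c y * (exp (- (y * cosh u)) * cos (c * u))" for y u
  have int: "integrable (hl \<Otimes>\<^sub>M hl) (case_prod f)"
  proof (rule Bochner_Integration.integrable_bound[OF integrable_pair_macdonald])
    show "AE z in hl \<Otimes>\<^sub>M hl. norm (case_prod f z) \<le> norm (case z of (y, u) \<Rightarrow> exp (- (y * cosh u)) * macdonald 0 y)"
      using AE_hl_pair
    proof eventually_elim
      case (elim z)
      obtain y u where z: "z = (y, u)" by force
      have "\<bar>macdonald c y\<bar> * (exp (- (y * cosh u)) * \<bar>cos (c * u)\<bar>) \<le> \<bar>macdonald 0 y\<bar> * (exp (- (y * cosh u)) * 1)"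
        using abs_macdonald_le[of y c] elim z by (intro mult_mono) auto
      then show ?case by (simp add: z f_def abs_mult mult_ac)
    qed
  qed (unfold f_def, measurable)
  have fst: "(\<integral>u. f y u \<partial>hl) = (macdonald c y)\<^sup>2" for y
    unfolding f_def by (simp add: macdonald_def power2_eq_square)
  show "integrable hl (\<lambda>y. (macdonald c y)\<^sup>2)"
    using hl_hl.integrable_fst'[OF int] by (simp add: fst)
  have "integral\<^sup>L hl (\<lambda>y. (macdonald c y)\<^sup>2) = (\<integral>u. \<integral>y. f y u \<partial>hl \<partial>hl)"
    using hl_hl.Fubini_integral[OF int] by (simp add: fst)
  also have "\<dots> = (\<integral>u. pi / (2 * sinh (pi * c)) * (sin (2 * c * u) / sinh u) \<partial>hl)"
  proof (rule integral_hl_cong)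
    fix u :: real assume u: "0 < u"
    have "(\<integral>y. f y u \<partial>hl) = (\<integral>y. cos (c * u) * (exp (- (y * cosh u)) * macdonald c y) \<partial>hl)"
      by (simp add: f_def mult_ac)
    also have "\<dots> = cos (c * u) * (pi * sin (c * u) / (sinh (pi * c) * sinh u))"
      by (simp add: laplace_macdonald assms u)
    also have "\<dots> = pi / (2 * sinh (pi * c)) * (sin (2 * c * u) / sinh u)"
      by (simp add: sin_double mult.assoc)
    finally show "(\<integral>y. f y u \<partial>hl) = pi / (2 * sinh (pi * c)) * (sin (2 * c * u) / sinh u)" .
  qed (unfold f_def, measurable)
  also have "\<dots> = pi / (2 * sinh (pi * c)) * integral\<^sup>L hl (\<lambda>u. sin (2 * c * u) / sinh u)" by (rule integral_mult_right_zero)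
  also have "\<dots> \<le> pi / (2 * sinh (pi * c)) * 2"
    using integral_hl_sin_over_sinh[of "2 * c"] assms by (intro mult_left_mono) auto
  finally show "integral\<^sup>L hl (\<lambda>y. (macdonald c y)\<^sup>2) \<le> pi / sinh (pi * c)" by simp
qed

section \<open>The expansion in incomplete Bessel functions\<close>

lemma einterval_0_infty: "einterval 0 \<infinity> = {0<..}"
  by (auto simp: einterval_def)

lemma
  fixes f :: "real \<Rightarrow> complex"
  assumes "f \<in> borel_measurable borel"
  shows interval_integral_0_infty: "(LBINT y=0..\<infinity>. f y) = integral\<^sup>L hl f"
    and interval_integrable_0_infty: "interval_lebesgue_integrable lborel 0 \<infinity> f \<longleftrightarrow> integrable hl f"
  using assms by (simp_all add: interval_lebesgue_integral_def interval_lebesgue_integrable_def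
     einterval_0_infty integral_hl integrable_hl_iff)

lemma interval_integral_0_infty_cong:
  fixes f g :: "real \<Rightarrow> complex"
  assumes "\<And>y. 0 < y \<Longrightarrow> f y = g y"
  shows "(LBINT y=0..\<infinity>. f y) = (LBINT y=0..\<infinity>. g y)"
    and "interval_lebesgue_integrable lborel 0 \<infinity> f \<longleftrightarrow> interval_lebesgue_integrable lborel 0 \<infinity> g"
proof -
  show "(LBINT y=0..\<infinity>. f y) = (LBINT y=0..\<infinity>. g y)"
    unfolding interval_lebesgue_integral_def einterval_0_infty
    using assms set_lebesgue_integral_cong[of "{0<..}" lborel f g] by simp
  have "(\<lambda>x. indicat_real {0<..} x *\<^sub>R f x) = (\<lambda>x. indicat_real {0<..} x *\<^sub>R g x)"
    using assms by (auto simp: fun_eq_iff indicator_def)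
  then show "interval_lebesgue_integrable lborel 0 \<infinity> f \<longleftrightarrow> interval_lebesgue_integrable lborel 0 \<infinity> g"
    by (simp add: interval_lebesgue_integrable_def einterval_0_infty set_integrable_def)
qed

lemma cosh_complex_of_real: "cosh (complex_of_real u) = complex_of_real (cosh u)"
  by (simp add: cosh_field_def exp_of_real[symmetric] del: exp_of_real)

lemma cosh_ii_times: "cosh (\<i> * complex_of_real c * complex_of_real u) = complex_of_real (cos (c * u))"
proof -
  have "cosh (\<i> * complex_of_real c * complex_of_real u) = cos (\<i> * (\<i> * complex_of_real c * complex_of_real u))"
    by (rule cosh_conv_cos)
  also have "\<i> * (\<i> * complex_of_real c * complex_of_real u) = complex_of_real (- (c * u))"
    by (simp add: mult.assoc[symmetric])
  finally show ?thesis by (simp only: cos_of_real cos_minus)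
qed

lemma bessel_K_eq_macdonald: "bessel_K (\<i> * complex_of_real c) y = complex_of_real (macdonald c y)"
proof -
  have "bessel_K (\<i> * complex_of_real c) y = (LBINT u=0..\<infinity>. complex_of_real (exp (- (y * cosh u)) * cos (c * u)))"
    by (simp add: bessel_K_def cosh_ii_times)
  also have "\<dots> = (\<integral>u. complex_of_real (exp (- (y * cosh u)) * cos (c * u)) \<partial>hl)"
    by (rule interval_integral_0_infty) measurable
  also have "\<dots> = complex_of_real (macdonald c y)"
    unfolding macdonald_def by (rule integral_complex_of_real)
  finally show ?thesis .
qed

lemma set_integral_HK:
  fixes f :: "real \<Rightarrow> 'a::euclidean_space"
  assumes "continuous_on {a..b} f"
  shows "(LINT u:{a..b}|lborel. f u) = integral {a..b} f"
  by (rule set_borel_integral_eq_integral(2)[OF set_integrable_continuous[OF assms]])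

lemma sine_coeff_set_integral:
  assumes "continuous_on {0..pi} g"
  shows "(LINT u:{0..pi}|lborel. complex_of_real (g u * sin (real n * u))) = complex_of_real (sine_coeff g n)"
proof -
  have "(LINT u:{0..pi}|lborel. complex_of_real (g u * sin (real n * u))) = complex_of_real (LINT u:{0..pi}|lborel. g u * sin (real n * u))"
    by (rule set_integral_complex_of_real)
  also have "(LINT u:{0..pi}|lborel. g u * sin (real n * u)) = sine_coeff g n"
    unfolding sine_coeff_def by (intro set_integral_HK continuous_intros assms)
  finally show ?thesis .
qed

text \<open>
  Integration by parts; the boundary terms vanish because \<open>sin (n u)\<close> is 0 at 0 and at \<open>\<pi>\<close>.
\<close>

lemma bessel_J_inc_eq:
  assumes n: "n \<ge> 1"
  shows "bessel_J_inc (complex_of_real x) (\<i> * complex_of_real (real n)) pi = 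
    complex_of_real (x / real n) * complex_of_real (sine_coeff (\<lambda>u. exp (- (x * cosh u)) * sinh u) n)"
proof -
  have "bessel_J_inc (complex_of_real x) (\<i> * complex_of_real (real n)) pi =
     (LBINT u=ereal 0..ereal pi. complex_of_real (exp (- (x * cosh u)) * cos (real n * u)))"
  proof -
    have "exp (- complex_of_real x * cosh (complex_of_real u)) = complex_of_real (exp (- (x * cosh u)))" for u
      by (simp add: cosh_complex_of_real flip: exp_of_real)
    then show ?thesis 
      unfolding bessel_J_inc_def cosh_ii_times zero_ereal_def of_real_mult by (simp only:)
  qed
  also have "\<dots> = (LINT u:{0..pi}|lborel. complex_of_real (exp (- (x * cosh u)) * cos (real n * u)))"
    by (rule interval_integral_Icc) simp
  also have "\<dots> = complex_of_real (LINT u:{0..pi}|lborel. exp (- (x * cosh u)) * cos (real n * u))"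
    by (rule set_integral_complex_of_real)
  also have "(LINT u:{0..pi}|lborel. exp (- (x * cosh u)) * cos (real n * u)) = 
      integral {0..pi} (\<lambda>u. exp (- (x * cosh u)) * cos (real n * u))"
    by (intro set_integral_HK continuous_intros)
  also have "\<dots> = x / real n * integral {0..pi} (\<lambda>u. exp (- (x * cosh u)) * sinh u * sin (real n * u))"
  proof -
    let ?F = "\<lambda>u. exp (- (x * cosh u)) * sin (real n * u) / real n"
    let ?f1 = "\<lambda>u. exp (- (x * cosh u)) * cos (real n * u)"
    let ?f2 = "\<lambda>u. exp (- (x * cosh u)) * sinh u * sin (real n * u)"
    have "((\<lambda>u. ?f1 u - x / real n * ?f2 u) has_integral (?F pi - ?F 0)) {0..pi}"
    proof (rule fundamental_theorem_of_calculus)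
      fix u
      have "((\<lambda>u. exp (- (x * cosh u)) * sin (real n * u)) has_real_derivative 
           real n * ?f1 u - x * ?f2 u) (at u within {0..pi})"
        by (auto intro!: derivative_eq_intros simp: algebra_simps)
      from DERIV_cdivide[OF this, of "real n"]
      show "(?F has_vector_derivative ?f1 u - x / real n * ?f2 u) (at u within {0..pi})"
        using n by (simp add: has_real_derivative_iff_has_vector_derivative diff_divide_distrib)
    qed simp
    then have "integral {0..pi} (\<lambda>u. ?f1 u - x / real n * ?f2 u) = ?F pi - ?F 0"
      by (rule integral_unique)
    also have "\<dots> = 0" by simp
    finally have "integral {0..pi} (\<lambda>u. ?f1 u - x / real n * ?f2 u) = 0" .
    moreover have "integral {0..pi} (\<lambda>u. ?f1 u - x / real n * ?f2 u) = integral {0..pi} ?f1 - integral {0..pi} (\<lambda>u. x / real n * ?f2 u)"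
      by (intro Henstock_Kurzweil_Integration.integral_diff integrable_continuous_interval continuous_intros)
    moreover have "integral {0..pi} (\<lambda>u. x / real n * ?f2 u) = x / real n * integral {0..pi} ?f2"
      by (rule Henstock_Kurzweil_Integration.integral_mult_right)
    ultimately show ?thesis by simp
  qed
  finally show ?thesis by (simp add: sine_coeff_def)
qed

lemma parseval_sine_complex:
  fixes h :: "real \<Rightarrow> complex"
  assumes h: "continuous_on {0..pi} h" and g: "continuous_on {0..pi} g"
  shows "(\<lambda>k. (LINT u:{0..pi}|lborel. h u * complex_of_real (sin (real (Suc k) * u))) * complex_of_real (sine_coeff g (Suc k))) sums
    (complex_of_real (pi / 2) * (LINT u:{0..pi}|lborel. h u * complex_of_real (g u)))"
proof -
  have hc: "continuous_on {0..pi} (\<lambda>u. Re (h u))" "continuous_on {0..pi} (\<lambda>u. Im (h u))"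
    by (intro continuous_intros h)+
  have split: "(LINT u:{0..pi}|lborel. h u * complex_of_real (k u)) = 
     complex_of_real (integral {0..pi} (\<lambda>u. Re (h u) * k u)) + \<i> * complex_of_real (integral {0..pi} (\<lambda>u. Im (h u) * k u))"
    if k: "continuous_on {0..pi} k" for k
  proof -
    have i: "set_integrable lborel {0..pi} (\<lambda>u. h u * complex_of_real (k u))"
      by (intro set_integrable_continuous continuous_intros h k)
    have "Re (LINT u:{0..pi}|lborel. h u * complex_of_real (k u)) = (LINT u:{0..pi}|lborel. Re (h u) * k u)"
      using integral_Re[OF i[unfolded set_integrable_def]] by (simp add: set_lebesgue_integral_def)
    also have "\<dots> = integral {0..pi} (\<lambda>u. Re (h u) * k u)"
      by (intro set_integral_HK continuous_intros hc k)
    finally have 1: "Re (LINT u:{0..pi}|lborel. h u * complex_of_real (k u)) = integral {0..pi} (\<lambda>u. Re (h u) * k u)" .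
    have "Im (LINT u:{0..pi}|lborel. h u * complex_of_real (k u)) = (LINT u:{0..pi}|lborel. Im (h u) * k u)"
      using integral_Im[OF i[unfolded set_integrable_def]] by (simp add: set_lebesgue_integral_def)
    also have "\<dots> = integral {0..pi} (\<lambda>u. Im (h u) * k u)"
      by (intro set_integral_HK continuous_intros hc k)
    finally show ?thesis using 1 by (simp add: complex_eq_iff)
  qed
  have "(\<lambda>k. complex_of_real (sine_coeff (\<lambda>u. Re (h u)) (Suc k) * sine_coeff g (Suc k)) + 
      \<i> * complex_of_real (sine_coeff (\<lambda>u. Im (h u)) (Suc k) * sine_coeff g (Suc k))) sums
    (complex_of_real (pi / 2 * integral {0..pi} (\<lambda>u. Re (h u) * g u)) + \<i> * complex_of_real (pi / 2 * integral {0..pi} (\<lambda>u. Im (h u) * g u)))"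
    by (intro sums_add sums_mult sums_of_real parseval_sine hc g)
  then show ?thesis
    by (subst split, intro continuous_intros, subst split[OF g]) (simp add: sine_coeff_def algebra_simps)
qed

text \<open>
  Only the odd part of \<open>\<psi>\<close> contributes.
\<close>

lemma symmetric_integral_eq_cosh_laplace:
  fixes \<psi> :: "real \<Rightarrow> complex"
  assumes \<psi>: "continuous_on {- pi..pi} \<psi>"
  shows "(LBINT u=ereal (- pi)..ereal pi. complex_of_real (exp (- x * cosh u)) * (\<psi> u * complex_of_real (sinh u)))
     = cosh_laplace (\<lambda>u. \<psi> u - \<psi> (- u)) x"
proof -
  let ?g = "\<lambda>u. complex_of_real (exp (- x * cosh u)) * (\<psi> u * complex_of_real (sinh u))"
  have c: "continuous_on {- pi..pi} ?g" by (intro continuous_intros \<psi>)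
  have c1: "continuous_on {0..pi} ?g" by (rule continuous_on_subset[OF c]) auto
  have c2: "continuous_on {0..pi} (\<lambda>u. ?g (- u))" 
    by (rule continuous_on_compose2[OF c, of _ uminus]) (auto intro!: continuous_intros)
  have "(LBINT u=ereal (- pi)..ereal pi. ?g u) = integral {- pi..pi} ?g"
    using interval_integral_Icc[of "-pi" pi ?g] set_integral_HK[OF c] by simp
  also have "\<dots> = integral {- pi..0} ?g + integral {0..pi} ?g"
    by (rule Henstock_Kurzweil_Integration.integral_combine[symmetric]) (simp, simp, rule integrable_continuous_interval[OF c])
  also have "integral {- pi..0} ?g = integral {0..pi} (\<lambda>u. ?g (- u))"
    using Henstock_Kurzweil_Integration.integral_reflect_real[of pi 0 "\<lambda>u. ?g (- u)"] 
    by (simp only: minus_minus minus_zero)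
  also have "\<dots> + integral {0..pi} ?g = integral {0..pi} (\<lambda>u. ?g (- u) + ?g u)"
    by (intro Henstock_Kurzweil_Integration.integral_add[symmetric] integrable_continuous_interval c1 c2)
  also have "\<dots> = (LINT u:{0..pi}|lborel. ?g (- u) + ?g u)"
    by (intro set_integral_HK[symmetric] continuous_on_add c1 c2)
  also have "\<dots> = cosh_laplace (\<lambda>u. \<psi> u - \<psi> (- u)) x"
    unfolding cosh_laplace_def by (simp add: algebra_simps)
  finally show ?thesis .
qed

lemma cosh_laplace_measurable:
  assumes "continuous_on UNIV h"
  shows "cosh_laplace h \<in> borel_measurable borel"
proof -
  have [measurable]: "h \<in> borel_measurable borel"
    using assms by (rule borel_measurable_continuous_onI)
  show ?thesis unfolding cosh_laplace_def set_lebesgue_integral_def by measurable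
qed

text \<open>
  The first expansion. Up to the common factor \<open>x \<pi>\<close>, the terms of the series are the products of the sine
  coefficients of \<open>\<psi>(u) - \<psi>(-u)\<close> and of \<open>exp (- x cosh u) sinh u\<close>, and Parseval's identity sums them.
\<close>

theorem bessel_J_inc_expansion:
  fixes f \<psi> :: "real \<Rightarrow> complex"
  assumes f: "\<And>x. x > 0 \<Longrightarrow> f x = (LBINT u=ereal (- pi)..ereal pi. complex_of_real (exp (- x * cosh u)) * (\<psi> u * complex_of_real (sinh u)))"
    and \<psi>: "continuous_on {- pi..pi} \<psi>"
  shows "n \<ge> 1 \<Longrightarrow> interval_lebesgue_integrable lborel 0 \<infinity> (\<lambda>y. bessel_K (\<i> * complex_of_real (real n)) y * f y)"
    and "x > 0 \<Longrightarrow> (\<lambda>k. let n = real (Suc k) in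
              complex_of_real (n * sinh (pi * n)) *
              bessel_J_inc (complex_of_real x) (\<i> * complex_of_real n) pi *
              (LBINT y=0..\<infinity>. bessel_K (\<i> * complex_of_real n) y * f y)) sums (complex_of_real (x * pi\<^sup>2 / 2) * f x)"
proof -
  \<comment> \<open>Only the values on \<open>[-\<pi>, \<pi>]\<close> matter; constant extension makes the function continuous on the line.\<close>
  define \<psi>' where "\<psi>' u = \<psi> (max (- pi) (min pi u))" for u
  have cont': "continuous_on UNIV \<psi>'"
    unfolding \<psi>'_def by (rule continuous_on_compose2[OF \<psi>]) (auto intro!: continuous_intros)
  define h where "h u = \<psi>' u - \<psi>' (- u)" for u
  have h: "continuous_on UNIV h"
    unfolding h_def by (intro continuous_intros cont' continuous_on_compose2[OF cont']) auto
  have hI: "continuous_on {0..pi} h" by (rule continuous_on_subset[OF h]) auto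
  have eq: "f x = cosh_laplace h x" if "x > 0" for x
  proof -
    have "f x = cosh_laplace (\<lambda>u. \<psi> u - \<psi> (- u)) x"
      using f[OF that] symmetric_integral_eq_cosh_laplace[OF \<psi>] by simp
    also have "\<dots> = cosh_laplace h x"
      unfolding cosh_laplace_def by (intro set_lebesgue_integral_cong) (auto simp: h_def \<psi>'_def)
    finally show ?thesis .
  qed
  have m: "(\<lambda>y. complex_of_real (macdonald c y) * cosh_laplace h y) \<in> borel_measurable borel" for c
    using cosh_laplace_measurable[OF h] by measurable
  have cong: "bessel_K (\<i> * complex_of_real c) y * f y = complex_of_real (macdonald c y) * cosh_laplace h y" if "0 < y" for c y
    using eq[OF that] by (simp add: bessel_K_eq_macdonald)
  show "interval_lebesgue_integrable lborel 0 \<infinity> (\<lambda>y. bessel_K (\<i> * complex_of_real (real n)) y * f y)" if "n \<ge> 1"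
    using that interval_integrable_0_infty[OF m] integrable_macdonald_cosh_laplace[OF h, of "real n"]
    by (subst interval_integral_0_infty_cong(2)[OF cong]) auto
  have int: "(LBINT y=0..\<infinity>. bessel_K (\<i> * complex_of_real c) y * f y) = 
    complex_of_real (pi / sinh (pi * c)) * (LINT u:{0..pi}|lborel. h u * complex_of_real (sin (c * u)))" if "c > 0" for c
    using interval_integral_0_infty[OF m] integral_macdonald_cosh_laplace[OF h that]
    by (subst interval_integral_0_infty_cong(1)[OF cong]) auto
  show "(\<lambda>k. let n = real (Suc k) in
              complex_of_real (n * sinh (pi * n)) *
              bessel_J_inc (complex_of_real x) (\<i> * complex_of_real n) pi *
              (LBINT y=0..\<infinity>. bessel_K (\<i> * complex_of_real n) y * f y)) sums (complex_of_real (x * pi\<^sup>2 / 2) * f x)"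
    if x: "x > 0"
  proof -
    let ?g = "\<lambda>u. exp (- (x * cosh u)) * sinh u"
    let ?c = "\<lambda>k. (LINT u:{0..pi}|lborel. h u * complex_of_real (sin (real (Suc k) * u)))"
    have main: "(\<lambda>k. complex_of_real (x * pi) * (?c k * complex_of_real (sine_coeff ?g (Suc k)))) sums
        (complex_of_real (x * pi) * (complex_of_real (pi / 2) * (LINT u:{0..pi}|lborel. h u * complex_of_real (?g u))))"
      by (intro sums_mult parseval_sine_complex hI continuous_intros)
    have "(LINT u:{0..pi}|lborel. h u * complex_of_real (?g u)) = f x"
      unfolding eq[OF x] cosh_laplace_def by (simp add: mult.commute)
    then have val: "complex_of_real (x * pi) * (complex_of_real (pi / 2) * (LINT u:{0..pi}|lborel. h u * complex_of_real (?g u)))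
        = complex_of_real (x * pi\<^sup>2 / 2) * f x"
      by (simp add: power2_eq_square)
    have trm: "(let n = real (Suc k) in
              complex_of_real (n * sinh (pi * n)) *
              bessel_J_inc (complex_of_real x) (\<i> * complex_of_real n) pi *
              (LBINT y=0..\<infinity>. bessel_K (\<i> * complex_of_real n) y * f y)) = 
       complex_of_real (x * pi) * (?c k * complex_of_real (sine_coeff ?g (Suc k)))" for k
    proof -
      define n where "n = real (Suc k)"
      have n: "n > 0" and s: "sinh (pi * n) > 0" by (simp_all add: n_def)
      have J: "bessel_J_inc (complex_of_real x) (\<i> * complex_of_real n) pi = complex_of_real (x / n) * complex_of_real (sine_coeff ?g (Suc k))"
        unfolding n_def by (rule bessel_J_inc_eq) simp
      have alg: "complex_of_real (n * sinh (pi * n)) * (complex_of_real (x / n) * j) * (complex_of_real (pi / sinh (pi * n)) * C)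
         = complex_of_real (x * pi) * (C * j)" for j C
      proof -
        have "complex_of_real (n * sinh (pi * n)) * (complex_of_real (x / n) * j) * (complex_of_real (pi / sinh (pi * n)) * C)
          = complex_of_real (n * sinh (pi * n) * (x / n) * (pi / sinh (pi * n))) * (C * j)"
          by simp
        also have "n * sinh (pi * n) * (x / n) * (pi / sinh (pi * n)) = x * pi"
          using n s by simp
        finally show ?thesis .
      qed
      show ?thesis
        unfolding Let_def n_def[symmetric] J int[OF n] by (rule alg)
    qed
    show ?thesis unfolding trm using main unfolding val .
  qed
qed

section \<open>The expansion in Macdonald functions\<close>

lemma AE_summable_norm:
  fixes f :: "nat \<Rightarrow> 'a \<Rightarrow> 'b :: {banach, second_countable_topology}"
  assumes f: "\<And>i. integrable M (f i)" and sum: "summable (\<lambda>i. \<integral>x. norm (f i x) \<partial>M)"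
  shows "AE x in M. summable (\<lambda>i. norm (f i x))"
proof -
  have [measurable]: "f i \<in> borel_measurable M" for i using f by auto
  have "(\<integral>\<^sup>+x. (\<Sum>i. ennreal (norm (f i x))) \<partial>M) = (\<Sum>i. \<integral>\<^sup>+x. ennreal (norm (f i x)) \<partial>M)"
    by (rule nn_integral_suminf) measurable
  also have "\<dots> = (\<Sum>i. ennreal (\<integral>x. norm (f i x) \<partial>M))"
    by (intro suminf_cong nn_integral_eq_integral integrable_norm f) simp
  also have "\<dots> = ennreal (\<Sum>i. \<integral>x. norm (f i x) \<partial>M)"
    by (intro suminf_ennreal2 sum) auto
  finally have fin: "(\<integral>\<^sup>+x. (\<Sum>i. ennreal (norm (f i x))) \<partial>M) \<noteq> \<infinity>"
    by (simp only: infinity_ennreal_def ennreal_neq_top not_False_eq_True)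
  have "AE x in M. (\<Sum>i. ennreal (norm (f i x))) \<noteq> \<infinity>"
    by (rule nn_integral_PInf_AE[OF _ fin]) measurable
  then show ?thesis
  proof eventually_elim
    case (elim x)
    then show ?case
      by (intro summable_suminf_not_top) (simp_all only: infinity_ennreal_def norm_ge_zero not_False_eq_True)
  qed
qed

text \<open>
  The decay rate \<open>exp (- \<pi> c / 2)\<close> matches exactly the weight in the summability hypothesis on the
  coefficients of the second expansion.
\<close>

lemma
  assumes c: "c \<ge> 1"
  shows integrable_exp_macdonald: "integrable hl (\<lambda>y. exp (- y) * \<bar>macdonald c y\<bar>)"
    and integral_exp_macdonald_le: "integral\<^sup>L hl (\<lambda>y. exp (- y) * \<bar>macdonald c y\<bar>) \<le> (1 / 4 + 2 * pi) * exp (- (pi * c / 2))"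
proof -
  have c0: "c > 0" using c by simp
  show i: "integrable hl (\<lambda>y. exp (- y) * \<bar>macdonald c y\<bar>)"
    by (rule hl_integrable_dominated[OF integrable_norm[OF integrable_macdonald[of c]]])
       (auto simp: abs_mult mult_left_le_one_le)
  define t where "t = exp (- (pi * c / 2))"
  have t: "t > 0" by (simp add: t_def)
  let ?b = "\<lambda>y. t / 2 * exp (- (2 * y)) + 1 / (2 * t) * (macdonald c y)\<^sup>2"
  have ib: "integrable hl (\<lambda>y. t / 2 * exp (- (2 * y)))" "integrable hl (\<lambda>y. 1 / (2 * t) * (macdonald c y)\<^sup>2)"
    by (intro integrable_mult_right integrable_hl_exp integrable_macdonald_square c0; simp)+
  have "integral\<^sup>L hl (\<lambda>y. exp (- y) * \<bar>macdonald c y\<bar>) \<le> integral\<^sup>L hl ?b"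
  proof (rule integral_mono[OF i])
    show "integrable hl ?b" using ib by (rule Bochner_Integration.integrable_add)
    fix y
    define a b where "a = exp (- y)" and "b = \<bar>macdonald c y\<bar>"
    have a2: "exp (- (2 * y)) = a\<^sup>2" and b2: "(macdonald c y)\<^sup>2 = b\<^sup>2" by (simp_all add: a_def b_def exp_double[symmetric])
    \<comment> \<open>Young's inequality; the weight \<open>t\<close> is the expected order of magnitude of the integral.\<close>
    have "0 \<le> (t * a - b)\<^sup>2 / (2 * t)" using t by simp
    also have "(t * a - b)\<^sup>2 / (2 * t) = t / 2 * a\<^sup>2 + 1 / (2 * t) * b\<^sup>2 - a * b"
      using t by (simp add: power2_eq_square field_simps)
    finally show "exp (- y) * \<bar>macdonald c y\<bar> \<le> ?b y" 
      unfolding a2 b2 by (simp add: a_def b_def)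
  qed
  also have "\<dots> = t / 2 * integral\<^sup>L hl (\<lambda>y. exp (- (2 * y))) + 1 / (2 * t) * integral\<^sup>L hl (\<lambda>y. (macdonald c y)\<^sup>2)"
    by (subst Bochner_Integration.integral_add[OF ib]) simp
  also have "\<dots> \<le> t / 2 * (1 / 2) + 1 / (2 * t) * (4 * pi * t\<^sup>2)"
  proof (intro add_mono mult_left_mono)
    have "integral\<^sup>L hl (\<lambda>y. (macdonald c y)\<^sup>2) \<le> pi / sinh (pi * c)" by (rule integral_macdonald_square[OF c0])
    also have "\<dots> \<le> 4 * pi * t\<^sup>2"
    proof -
      have t2: "t\<^sup>2 = exp (- (pi * c))" by (simp add: t_def exp_double[symmetric])
      have "1 \<le> pi * c" using c pi_ge_two mult_mono[of 1 pi 1 c] by simp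
      then have "2 \<le> exp (pi * c)" using exp_ge_add_one_self[of "pi * c"] by linarith
      moreover have "exp (- (pi * c)) \<le> 1" using c0 by simp
      moreover have "sinh (pi * c) = (exp (pi * c) - exp (- (pi * c))) / 2" by (simp add: sinh_def)
      moreover have "E / 4 \<le> (E - e) / 2" if "2 \<le> E" "e \<le> 1" for E e :: real
        using that by (simp add: field_simps)
      ultimately have "exp (pi * c) / 4 \<le> sinh (pi * c)" by metis
      then have "pi / sinh (pi * c) \<le> pi / (exp (pi * c) / 4)" using c0 by (intro divide_left_mono) auto
      also have "\<dots> = 4 * pi * t\<^sup>2" by (simp add: t2 exp_minus field_simps)
      finally show ?thesis .
    qed
    finally show "integral\<^sup>L hl (\<lambda>y. (macdonald c y)\<^sup>2) \<le> 4 * pi * t\<^sup>2" .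
    show "integral\<^sup>L hl (\<lambda>y. exp (- (2 * y))) \<le> 1 / 2" using integral_hl_exp[of 2] by simp
  qed (use t in auto)
  also have "\<dots> = (1 / 4 + 2 * pi) * t" using t by (simp add: power2_eq_square algebra_simps)
  finally show "integral\<^sup>L hl (\<lambda>y. exp (- y) * \<bar>macdonald c y\<bar>) \<le> (1 / 4 + 2 * pi) * exp (- (pi * c / 2))"
    by (simp add: t_def)
qed

lemma cosh_laplace_sin:
  "cosh_laplace (\<lambda>u. complex_of_real (sin (real n * u))) x = complex_of_real (sine_coeff (\<lambda>u. exp (- (x * cosh u)) * sinh u) n)"
proof -
  have "cosh_laplace (\<lambda>u. complex_of_real (sin (real n * u))) x = (LINT u:{0..pi}|lborel. complex_of_real (exp (- (x * cosh u)) * sinh u * sin (real n * u)))"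
    by (simp add: cosh_laplace_def)
  also have "\<dots> = complex_of_real (sine_coeff (\<lambda>u. exp (- (x * cosh u)) * sinh u) n)"
    by (intro sine_coeff_set_integral continuous_intros)
  finally show ?thesis .
qed

lemma norm_cosh_laplace_sin_le:
  assumes "x > 0"
  shows "norm (cosh_laplace (\<lambda>u. complex_of_real (sin (real n * u))) x) \<le> sinh pi * pi * exp (- x)"
proof -
  have "norm (integral {0..pi} (\<lambda>u. exp (- (x * cosh u)) * sinh u * sin (real n * u))) \<le> (exp (- x) * sinh pi) * (pi - 0)"
  proof (rule integral_bound)
    fix u assume u: "u \<in> {0..pi}"
    have "x * 1 \<le> x * cosh u" using assms cosh_real_ge_1[of u] by (intro mult_left_mono) auto
    then have "exp (- (x * cosh u)) * sinh u * \<bar>sin (real n * u)\<bar> \<le> exp (- x) * sinh pi * 1"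
      using u by (intro mult_mono) auto
    then show "norm (exp (- (x * cosh u)) * sinh u * sin (real n * u)) \<le> exp (- x) * sinh pi"
      using u by (simp add: abs_mult)
  qed (auto intro!: continuous_intros)
  then show ?thesis unfolding cosh_laplace_sin sine_coeff_def norm_of_real by (simp add: mult_ac)
qed

text \<open>
  The functions \<open>J(y, in, \<pi>) / y\<close> are biorthogonal to the functions \<open>K\<^bsub>im\<^esub>(y)\<close>, by orthogonality of the sines, so
  integrating the series of \<open>f\<close> term by term isolates the coefficient \<open>a\<^sub>n\<close>.
\<close>

theorem bessel_K_expansion_coeff:
  fixes f :: "real \<Rightarrow> complex" and a :: "nat \<Rightarrow> complex"
  assumes a: "summable (\<lambda>k. cmod (a (Suc k)) * exp (- pi * real (Suc k) / 2))"
    and f: "\<And>x. x > 0 \<Longrightarrow> (\<lambda>k. a (Suc k) * bessel_K (\<i> * complex_of_real (real (Suc k))) x) sums f x"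
  shows "n \<ge> 1 \<Longrightarrow> interval_lebesgue_integrable lborel 0 \<infinity> 
           (\<lambda>y. bessel_J_inc (complex_of_real y) (\<i> * complex_of_real (real n)) pi * f y / complex_of_real y)"
    and "n \<ge> 1 \<Longrightarrow> (LBINT y=0..\<infinity>. bessel_J_inc (complex_of_real y) (\<i> * complex_of_real (real n)) pi * f y / complex_of_real y) =
           complex_of_real (pi\<^sup>2 / (2 * real n * sinh (pi * real n))) * a n"
proof -
  assume n: "n \<ge> 1"
  let ?s = "\<lambda>u. complex_of_real (sin (real n * u))"
  have s: "continuous_on UNIV ?s" by (intro continuous_intros)
  have [measurable]: "cosh_laplace ?s \<in> borel_measurable borel" by (rule cosh_laplace_measurable[OF s])
  define g where "g k y = a (Suc k) / of_nat n * (complex_of_real (macdonald (real (Suc k)) y) * cosh_laplace ?s y)" for k y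
  have [measurable]: "g k \<in> borel_measurable borel" for k unfolding g_def by measurable
  have ig: "integrable hl (g k)" for k
    unfolding g_def by (intro integrable_mult_right integrable_macdonald_cosh_laplace s) simp
  define B where "B = sinh pi * pi"
  have B: "B \<ge> 0" by (simp add: B_def)
  have ing: "(\<integral>y. norm (g k y) \<partial>hl) \<le> B * (1 / 4 + 2 * pi) * (cmod (a (Suc k)) * exp (- pi * real (Suc k) / 2))" for k
  proof -
    let ?c = "real (Suc k)"
    have "(\<integral>y. norm (g k y) \<partial>hl) \<le> (\<integral>y. cmod (a (Suc k)) * B * (exp (- y) * \<bar>macdonald ?c y\<bar>) \<partial>hl)"
    proof (rule integral_mono_AE)
      show "AE y in hl. norm (g k y) \<le> cmod (a (Suc k)) * B * (exp (- y) * \<bar>macdonald ?c y\<bar>)"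
      proof (rule AE_hlI)
        fix y :: real assume y: "0 < y"
        have "norm (g k y) = cmod (a (Suc k)) / real n * (\<bar>macdonald ?c y\<bar> * norm (cosh_laplace ?s y))"
          by (simp add: g_def norm_mult norm_divide)
        also have "\<dots> \<le> cmod (a (Suc k)) / 1 * (\<bar>macdonald ?c y\<bar> * (B * exp (- y)))"
          using n norm_cosh_laplace_sin_le[OF y, of n] unfolding B_def
          by (intro mult_mono divide_left_mono mult_left_mono) auto
        finally show "norm (g k y) \<le> cmod (a (Suc k)) * B * (exp (- y) * \<bar>macdonald ?c y\<bar>)" by (simp add: mult_ac)
      qed
    qed (intro integrable_norm ig, intro integrable_mult_right integrable_exp_macdonald, simp)
    also have "\<dots> = cmod (a (Suc k)) * B * (\<integral>y. exp (- y) * \<bar>macdonald ?c y\<bar> \<partial>hl)" by (rule integral_mult_right_zero)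
    also have "\<dots> \<le> cmod (a (Suc k)) * B * ((1 / 4 + 2 * pi) * exp (- (pi * ?c / 2)))"
      using B by (intro mult_left_mono integral_exp_macdonald_le) auto
    also have "\<dots> = B * (1 / 4 + 2 * pi) * (cmod (a (Suc k)) * exp (- pi * ?c / 2))"
    proof -
      have "- pi * ?c / 2 = - (pi * ?c / 2)" by simp
      then show ?thesis by (simp only: mult_ac)
    qed
    finally show ?thesis .
  qed
  have sumg: "summable (\<lambda>k. \<integral>y. norm (g k y) \<partial>hl)"
    by (rule summable_comparison_test'[OF summable_mult[OF a, of "B * (1 / 4 + 2 * pi)"]]) (use ing in simp)
  note ae = AE_summable_norm[OF ig sumg]
  have gsum: "bessel_J_inc (complex_of_real y) (\<i> * complex_of_real (real n)) pi * f y / complex_of_real y = (\<Sum>k. g k y)" if y: "0 < y" for y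
  proof -
    have "(\<lambda>k. cosh_laplace ?s y / of_nat n * (a (Suc k) * bessel_K (\<i> * complex_of_real (real (Suc k))) y)) sums 
        (cosh_laplace ?s y / of_nat n * f y)"
      by (intro sums_mult f y)
    moreover have "cosh_laplace ?s y / of_nat n * (a (Suc k) * bessel_K (\<i> * complex_of_real (real (Suc k))) y) = g k y" for k
      unfolding bessel_K_eq_macdonald g_def by (simp add: mult_ac)
    ultimately have "(\<lambda>k. g k y) sums (cosh_laplace ?s y / of_nat n * f y)" by simp
    then have "(\<Sum>k. g k y) = cosh_laplace ?s y / of_nat n * f y" by (rule sums_unique[symmetric])
    moreover have "bessel_J_inc (complex_of_real y) (\<i> * complex_of_real (real n)) pi = complex_of_real y / of_nat n * cosh_laplace ?s y"
      using bessel_J_inc_eq[OF n, of y] by (simp add: cosh_laplace_sin)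
    ultimately show ?thesis using y by simp
  qed
  have m: "(\<lambda>y. \<Sum>k. g k y) \<in> borel_measurable borel" by measurable
  show "interval_lebesgue_integrable lborel 0 \<infinity> 
           (\<lambda>y. bessel_J_inc (complex_of_real y) (\<i> * complex_of_real (real n)) pi * f y / complex_of_real y)"
    using interval_integrable_0_infty[OF m] integrable_suminf[OF ig ae sumg]
    by (subst interval_integral_0_infty_cong(2)[OF gsum]) auto
  have intg: "integral\<^sup>L hl (g k) = (if k = n - 1 then complex_of_real (pi\<^sup>2 / (2 * real n * sinh (pi * real n))) * a n else 0)" for k
  proof -
    have "integral\<^sup>L hl (g k) = a (Suc k) / of_nat n * (complex_of_real (pi / sinh (pi * real (Suc k))) *
        (LINT u:{0..pi}|lborel. ?s u * complex_of_real (sin (real (Suc k) * u))))"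
      unfolding g_def integral_mult_right_zero by (subst integral_macdonald_cosh_laplace[OF s]) simp_all
    also have "(LINT u:{0..pi}|lborel. ?s u * complex_of_real (sin (real (Suc k) * u))) = complex_of_real (if n = Suc k then pi / 2 else 0)"
    proof -
      have "(LINT u:{0..pi}|lborel. complex_of_real (sin (real n * u) * sin (real (Suc k) * u))) = complex_of_real (sine_coeff (\<lambda>u. sin (real n * u)) (Suc k))"
        by (intro sine_coeff_set_integral continuous_intros)
      then show ?thesis unfolding sine_coeff_sin[OF n] of_real_mult .
    qed
    finally show ?thesis using n by (auto simp: power2_eq_square mult_ac simp del: of_nat_Suc)
  qed
  have "(LBINT y=0..\<infinity>. bessel_J_inc (complex_of_real y) (\<i> * complex_of_real (real n)) pi * f y / complex_of_real y) = integral\<^sup>L hl (\<lambda>y. \<Sum>k. g k y)"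
    using interval_integral_0_infty[OF m] by (subst interval_integral_0_infty_cong(1)[OF gsum]) auto
  also have "\<dots> = (\<Sum>k. integral\<^sup>L hl (g k))" by (rule integral_suminf[OF ig ae sumg])
  also have "\<dots> = complex_of_real (pi\<^sup>2 / (2 * real n * sinh (pi * real n))) * a n"
    unfolding intg by (rule sums_unique[symmetric, OF sums_single])
  finally show "(LBINT y=0..\<infinity>. bessel_J_inc (complex_of_real y) (\<i> * complex_of_real (real n)) pi * f y / complex_of_real y) =
           complex_of_real (pi\<^sup>2 / (2 * real n * sinh (pi * real n))) * a n" .
qed

lemma lipschitz_continuous_on:
  fixes \<psi> :: "real \<Rightarrow> complex"
  assumes "\<forall>u\<in>S. \<forall>v\<in>S. cmod (\<psi> u - \<psi> v) \<le> C * \<bar>u - v\<bar>" "C > 0"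
  shows "continuous_on S \<psi>"
  by (rule lipschitz_on_continuous_on[of C]) (use assms in \<open>auto simp: lipschitz_on_def dist_norm\<close>)

theorem theorem5:
  fixes f :: "real \<Rightarrow> complex"
  shows
    "(\<forall>(\<phi> :: real \<Rightarrow> complex) (\<psi> :: real \<Rightarrow> complex) (C :: real).
        (\<forall>x>0. f x = (LBINT u=ereal (- pi)..ereal pi. complex_of_real (exp (- x * cosh u)) * \<phi> u)) \<and>
        (\<forall>u. \<phi> u = \<psi> u * complex_of_real (sinh u)) \<and>
        (\<forall>u. \<psi> (u + 2 * pi) = \<psi> u) \<and>
        C > 0 \<and>
        (\<forall>u\<in>{- pi..pi}. \<forall>v\<in>{- pi..pi}. cmod (\<psi> u - \<psi> v) \<le> C * \<bar>u - v\<bar>)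
      \<longrightarrow>
        (\<forall>n\<ge>1. interval_lebesgue_integrable lborel 0 \<infinity>
                  (\<lambda>y. bessel_K (\<i> * complex_of_real (real n)) y * f y)) \<and>
        (\<forall>x>0. \<exists>S.
           (\<lambda>k. let n = real (Suc k) in
              complex_of_real (n * sinh (pi * n)) *
              bessel_J_inc (complex_of_real x) (\<i> * complex_of_real n) pi *
              (LBINT y=0..\<infinity>. bessel_K (\<i> * complex_of_real n) y * f y)) sums S \<and>
           f x = complex_of_real (2 / (x * pi\<^sup>2)) * S))
     \<and>
     (\<forall>a :: nat \<Rightarrow> complex.
        summable (\<lambda>k. cmod (a (Suc k)) * exp (- pi * real (Suc k) / 2)) \<and>
        (\<forall>x>0. (\<lambda>k. a (Suc k) * bessel_K (\<i> * complex_of_real (real (Suc k))) x) sums f x)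
      \<longrightarrow>
        (\<forall>n\<ge>1. interval_lebesgue_integrable lborel 0 \<infinity>
                  (\<lambda>y. bessel_J_inc (complex_of_real y) (\<i> * complex_of_real (real n)) pi * f y
                        / complex_of_real y)) \<and>
        (\<forall>x>0. \<exists>S.
           (\<lambda>k. let n = real (Suc k) in
              complex_of_real (n * sinh (pi * n)) *
              bessel_K (\<i> * complex_of_real n) x *
              (LBINT y=0..\<infinity>. bessel_J_inc (complex_of_real y) (\<i> * complex_of_real n) pi * f y
                                / complex_of_real y)) sums S \<and>
           f x = complex_of_real (2 / pi\<^sup>2) * S))"
proof (intro conjI allI impI; (elim conjE)?)
  fix \<phi> \<psi> :: "real \<Rightarrow> complex" and C :: real
  assume f: "\<forall>x>0. f x = (LBINT u=ereal (- pi)..ereal pi. complex_of_real (exp (- x * cosh u)) * \<phi> u)"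
    and \<phi>: "\<forall>u. \<phi> u = \<psi> u * complex_of_real (sinh u)"
    and C: "C > 0" "\<forall>u\<in>{- pi..pi}. \<forall>v\<in>{- pi..pi}. cmod (\<psi> u - \<psi> v) \<le> C * \<bar>u - v\<bar>"
  have cont: "continuous_on {- pi..pi} \<psi>" by (rule lipschitz_continuous_on[OF C(2,1)])
  have f': "f x = (LBINT u=ereal (- pi)..ereal pi. complex_of_real (exp (- x * cosh u)) * (\<psi> u * complex_of_real (sinh u)))" if "x > 0" for x
    using f that \<phi> by simp
  show "interval_lebesgue_integrable lborel 0 \<infinity> (\<lambda>y. bessel_K (\<i> * complex_of_real (real n)) y * f y)" if "1 \<le> n" for n
    by (rule bessel_J_inc_expansion(1)[OF f' cont that])
  show "\<exists>S. (\<lambda>k. let n = real (Suc k) in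
              complex_of_real (n * sinh (pi * n)) *
              bessel_J_inc (complex_of_real x) (\<i> * complex_of_real n) pi *
              (LBINT y=0..\<infinity>. bessel_K (\<i> * complex_of_real n) y * f y)) sums S \<and>
           f x = complex_of_real (2 / (x * pi\<^sup>2)) * S" if x: "0 < x" for x
  proof (intro exI conjI)
    show "f x = complex_of_real (2 / (x * pi\<^sup>2)) * (complex_of_real (x * pi\<^sup>2 / 2) * f x)"
      using x by simp
  qed (rule bessel_J_inc_expansion(2)[OF f' cont x])
next
  fix a :: "nat \<Rightarrow> complex"
  assume a: "summable (\<lambda>k. cmod (a (Suc k)) * exp (- pi * real (Suc k) / 2))"
    and f: "\<forall>x>0. (\<lambda>k. a (Suc k) * bessel_K (\<i> * complex_of_real (real (Suc k))) x) sums f x"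
  have f': "(\<lambda>k. a (Suc k) * bessel_K (\<i> * complex_of_real (real (Suc k))) x) sums f x" if "x > 0" for x
    using f that by blast
  show "interval_lebesgue_integrable lborel 0 \<infinity>
                  (\<lambda>y. bessel_J_inc (complex_of_real y) (\<i> * complex_of_real (real n)) pi * f y
                        / complex_of_real y)" if "1 \<le> n" for n
    by (rule bessel_K_expansion_coeff(1)[OF a f' that])
  show "\<exists>S. (\<lambda>k. let n = real (Suc k) in
              complex_of_real (n * sinh (pi * n)) *
              bessel_K (\<i> * complex_of_real n) x *
              (LBINT y=0..\<infinity>. bessel_J_inc (complex_of_real y) (\<i> * complex_of_real n) pi * f y
                                / complex_of_real y)) sums S \<and>
           f x = complex_of_real (2 / pi\<^sup>2) * S" if x: "0 < x" for x
  proof (intro exI conjI)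
    show "f x = complex_of_real (2 / pi\<^sup>2) * (complex_of_real (pi\<^sup>2 / 2) * f x)" by simp
    have trm: "(let n = real (Suc k) in
              complex_of_real (n * sinh (pi * n)) *
              bessel_K (\<i> * complex_of_real n) x *
              (LBINT y=0..\<infinity>. bessel_J_inc (complex_of_real y) (\<i> * complex_of_real n) pi * f y
                                / complex_of_real y)) = 
          complex_of_real (pi\<^sup>2 / 2) * (a (Suc k) * bessel_K (\<i> * complex_of_real (real (Suc k))) x)" for k
    proof -
      have coeff: "(LBINT y=0..\<infinity>. bessel_J_inc (complex_of_real y) (\<i> * complex_of_real (real (Suc k))) pi * f y / complex_of_real y) =
           complex_of_real (pi\<^sup>2 / (2 * real (Suc k) * sinh (pi * real (Suc k)))) * a (Suc k)"
        by (rule bessel_K_expansion_coeff(2)[OF a f']) simp_all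
      define n where "n = real (Suc k)"
      have n: "n > 0" "sinh (pi * n) > 0" by (simp_all add: n_def)
      have "complex_of_real (n * sinh (pi * n)) * K * (complex_of_real (pi\<^sup>2 / (2 * n * sinh (pi * n))) * c)
          = complex_of_real (pi\<^sup>2 / 2) * (c * K)" for K c
      proof -
        have "complex_of_real (n * sinh (pi * n)) * K * (complex_of_real (pi\<^sup>2 / (2 * n * sinh (pi * n))) * c)
          = complex_of_real (n * sinh (pi * n) * (pi\<^sup>2 / (2 * n * sinh (pi * n)))) * (c * K)"
          by simp
        also have "n * sinh (pi * n) * (pi\<^sup>2 / (2 * n * sinh (pi * n))) = pi\<^sup>2 / 2"
          using n by simp
        finally show ?thesis .
      qed
      then show ?thesis
        unfolding Let_def coeff unfolding n_def[symmetric] .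
    qed
    show "(\<lambda>k. let n = real (Suc k) in
              complex_of_real (n * sinh (pi * n)) *
              bessel_K (\<i> * complex_of_real n) x *
              (LBINT y=0..\<infinity>. bessel_J_inc (complex_of_real y) (\<i> * complex_of_real n) pi * f y
                                / complex_of_real y)) sums (complex_of_real (pi\<^sup>2 / 2) * f x)"
      unfolding trm by (intro sums_mult f' x)
  qed
qed

end
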